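(* Let $F_\varepsilon$ be an analytic (or $C^\infty$, or formal) family of area-preserving maps defined in a neighbourhood of the origin of $\mathbb{R}^2$, depending on a real parameter $\varepsilon$ near $0$, such that $F_0(0)=0$, and the Jacobian matrix $DF_0(0)$ has the double eigenvalue $\mu_0=1$ and is not diagonalisable. Then there exists a canonical (possibly orientation-reflecting) formal change of variables $\phi_\varepsilon$ such that $$F_\varepsilon=\phi_\varepsilon^{-1}\circ\Phi^1_{h_\varepsilon}\circ\phi_\varepsilon$$ with $$h_\varepsilon(x,y)=\frac{y^2}{2}+U_\varepsilon(x),\qquad U_\varepsilon(x)=\sum_{k+3m\ge 3}u_{km}x^k\varepsilon^m,$$ where $U_\varepsilon(x)$ is a formal power series in the two variables $x,\varepsilon$ with real coefficients (sum over integers $k,m\ge0$).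
   Context: A family $F_\varepsilon$ is analytic (resp. $C^\infty$, formal) jointly in $(x,y,\varepsilon)$ and is identified with its Taylor series at $(x,y,\varepsilon)=(0,0,0)$, a pair of formal power series in $(x,y,\varepsilon)$; all conjugacy identities are identities of formal power series. Area-preserving means that the Jacobian determinant with respect to $(x,y)$ is $\pm1$ (here it is $1$, since $\det DF_0(0)=1$). A canonical formal change of variables is a pair $\phi_\varepsilon$ of formal power series in $(x,y,\varepsilon)$ with $\phi_0(0,0)=(0,0)$ whose Jacobian determinant with respect to $(x,y)$ is identically $1$; "possibly orientation-reflecting" means that determinant identically $-1$ is also allowed. Compositions are in the variables $(x,y)$, with $\varepsilon$ as a parameter. For formal series, $\{f,g\}=\partial_xf\,\partial_yg-\partial_yf\,\partial_xg$ and $L_\chi g=\{g,\chi\}$. The formal time-one map of $\chi$ is $\Phi^1_\chi(x,y)=(\exp(L_\chi)x,\exp(L_\chi)y)$, where $\exp(L_\chi)g=\sum_{k\ge0}\frac1{k!}L_\chi^kg$. Here it is well defined coefficientwise because, assigning orders $2,3,6$ to $x,y,\varepsilon$, the series $h_\varepsilon$ contains (besides constants) only monomials of order at least $6$. *)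

theory Defs
  imports
    "HOL-Analysis.Analysis"
    "HOL-Computational_Algebra.Formal_Power_Series"
    "Jordan_Normal_Form.Char_Poly"
begin

text \<open>
  A formal power series in \<open>(x, y, \<epsilon>)\<close> is an element of \<open>\<real>[[\<epsilon>]][[y]][[x]]\<close>: the outermost
  variable is \<open>x\<close>, the innermost one \<open>\<epsilon>\<close>. The ring structure is the one of the library.
\<close>

type_synonym fps3 = "real fps fps fps"

type_synonym formal_map = "fps3 \<times> fps3"

definition coeff3 :: "fps3 \<Rightarrow> nat \<Rightarrow> nat \<Rightarrow> nat \<Rightarrow> real" where
  "coeff3 f i j k = fps_nth (fps_nth (fps_nth f i) j) k"

definition series3 :: "(nat \<Rightarrow> nat \<Rightarrow> nat \<Rightarrow> real) \<Rightarrow> fps3" where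
  "series3 c = Abs_fps (\<lambda>i. Abs_fps (\<lambda>j. Abs_fps (\<lambda>k. c i j k)))"

definition const3 :: "real \<Rightarrow> fps3" where
  "const3 c = fps_const (fps_const (fps_const c))"

definition var_x :: fps3 where "var_x = fps_X"

definition var_y :: fps3 where "var_y = fps_const fps_X"

definition var_eps :: fps3 where "var_eps = fps_const (fps_const fps_X)"

definition deriv_x :: "fps3 \<Rightarrow> fps3" where
  "deriv_x f = fps_deriv f"

definition deriv_y :: "fps3 \<Rightarrow> fps3" where
  "deriv_y f = Abs_fps (\<lambda>i. fps_deriv (fps_nth f i))"

definition jacobian :: "formal_map \<Rightarrow> fps3" where
  "jacobian F = deriv_x (fst F) * deriv_y (snd F) - deriv_y (fst F) * deriv_x (snd F)"

definition fixes_origin :: "formal_map \<Rightarrow> bool" where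
  "fixes_origin F \<longleftrightarrow> coeff3 (fst F) 0 0 0 = 0 \<and> coeff3 (snd F) 0 0 0 = 0"

text \<open>The matrix \<open>DF\<^sub>0(0)\<close>.\<close>

definition jacobian_matrix_0 :: "formal_map \<Rightarrow> real mat" where
  "jacobian_matrix_0 F = mat_of_rows_list 2
     [[coeff3 (deriv_x (fst F)) 0 0 0, coeff3 (deriv_y (fst F)) 0 0 0],
      [coeff3 (deriv_x (snd F)) 0 0 0, coeff3 (deriv_y (snd F)) 0 0 0]]"

definition diagonalisable_mat :: "real mat \<Rightarrow> bool" where
  "diagonalisable_mat A \<longleftrightarrow> (\<exists>D. similar_mat A D \<and> diagonal_mat D)"

text \<open>
  Substitution \<open>f(g\<^sub>1, g\<^sub>2, \<epsilon>)\<close>. If \<open>g\<^sub>1, g\<^sub>2\<close> have no constant term, then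
  \<open>g\<^sub>1\<^sup>i g\<^sub>2\<^sup>j \<epsilon>\<^sup>k\<close> contains only monomials of total degree at least \<open>i + j + k\<close>, so the
  coefficient of \<open>x\<^sup>a y\<^sup>b \<epsilon>\<^sup>c\<close> receives contributions only from \<open>i + j + k \<le> a + b + c\<close>.
  The definition is meaningful only in that case; compare \<^const>\<open>fps_compose\<close>.
\<close>

definition subst3 :: "fps3 \<Rightarrow> formal_map \<Rightarrow> fps3" where
  "subst3 f G = series3 (\<lambda>a b c.
     \<Sum>(i, j, k) \<in> {(i, j, k). i + j + k \<le> a + b + c}.
       coeff3 f i j k * coeff3 (fst G ^ i * snd G ^ j * var_eps ^ k) a b c)"

definition formal_comp :: "formal_map \<Rightarrow> formal_map \<Rightarrow> formal_map"  (infixl "\<circ>\<^sub>f" 55) where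
  "F \<circ>\<^sub>f G = (subst3 (fst F) G, subst3 (snd F) G)"

definition formal_id :: formal_map where
  "formal_id = (var_x, var_y)"

definition is_formal_inverse :: "formal_map \<Rightarrow> formal_map \<Rightarrow> bool" where
  "is_formal_inverse \<phi> \<psi> \<longleftrightarrow>
     fixes_origin \<phi> \<and> fixes_origin \<psi> \<and> \<phi> \<circ>\<^sub>f \<psi> = formal_id \<and> \<psi> \<circ>\<^sub>f \<phi> = formal_id"

text \<open>Canonical, possibly orientation-reflecting, formal changes of variables.\<close>

definition canonical_change :: "formal_map \<Rightarrow> bool" where
  "canonical_change \<phi> \<longleftrightarrow> fixes_origin \<phi> \<and> (jacobian \<phi> = 1 \<or> jacobian \<phi> = -1)"

definition poisson :: "fps3 \<Rightarrow> fps3 \<Rightarrow> fps3" where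
  "poisson f g = deriv_x f * deriv_y g - deriv_y f * deriv_x g"

definition lie_op :: "fps3 \<Rightarrow> fps3 \<Rightarrow> fps3" where
  "lie_op h g = poisson g h"

text \<open>
  The exponential series is summed coefficientwise. With the weights \<open>2, 3, 6\<close> of \<open>x, y, \<epsilon>\<close>,
  if \<open>h\<close> has only monomials of weight at least \<open>6\<close> then \<open>lie_op h\<close> raises the weight by at
  least \<open>1\<close>, and each of the sums below has only finitely many nonzero terms.
\<close>

definition lie_exp :: "fps3 \<Rightarrow> fps3 \<Rightarrow> fps3" where
  "lie_exp h g = series3 (\<lambda>a b c. \<Sum>n. coeff3 ((lie_op h ^^ n) g) a b c / fact n)"

definition time_one_map :: "fps3 \<Rightarrow> formal_map" where
  "time_one_map h = (lie_exp h var_x, lie_exp h var_y)"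

text \<open>The series \<open>U\<^sub>\<epsilon>(x) = \<Sum>\<^bsub>k + 3 m \<ge> 3\<^esub> u\<^sub>k\<^sub>m x\<^sup>k \<epsilon>\<^sup>m\<close>.\<close>

definition potential :: "(nat \<Rightarrow> nat \<Rightarrow> real) \<Rightarrow> fps3" where
  "potential u = series3 (\<lambda>k j m. if j = 0 \<and> k + 3 * m \<ge> 3 then u k m else 0)"

definition normal_form_hamiltonian :: "(nat \<Rightarrow> nat \<Rightarrow> real) \<Rightarrow> fps3" where
  "normal_form_hamiltonian u = const3 (1 / 2) * var_y ^ 2 + potential u"

text \<open>
  Smooth and analytic families are functions of \<open>(x, y, \<epsilon>)\<close> on an open neighbourhood of the
  origin of \<open>\<real>\<^sup>3\<close>.
\<close>

definition partial :: "'a::euclidean_space \<Rightarrow> ('a \<Rightarrow> real) \<Rightarrow> 'a \<Rightarrow> real" where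
  "partial v f p = frechet_derivative f (at p) v"

primrec Ck_on :: "nat \<Rightarrow> 'a::euclidean_space set \<Rightarrow> ('a \<Rightarrow> real) \<Rightarrow> bool" where
  "Ck_on 0 U f \<longleftrightarrow> continuous_on U f"
| "Ck_on (Suc n) U f \<longleftrightarrow>
     (\<forall>p\<in>U. f differentiable (at p)) \<and> (\<forall>v\<in>Basis. Ck_on n U (partial v f))"

definition smooth_on :: "'a::euclidean_space set \<Rightarrow> ('a \<Rightarrow> real) \<Rightarrow> bool" where
  "smooth_on U f \<longleftrightarrow> (\<forall>n. Ck_on n U f)"

abbreviation partial_x :: "(real \<times> real \<times> real \<Rightarrow> real) \<Rightarrow> real \<times> real \<times> real \<Rightarrow> real" where
  "partial_x \<equiv> partial (1, 0, 0)"

abbreviation partial_y :: "(real \<times> real \<times> real \<Rightarrow> real) \<Rightarrow> real \<times> real \<times> real \<Rightarrow> real" where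
  "partial_y \<equiv> partial (0, 1, 0)"

abbreviation partial_eps :: "(real \<times> real \<times> real \<Rightarrow> real) \<Rightarrow> real \<times> real \<times> real \<Rightarrow> real" where
  "partial_eps \<equiv> partial (0, 0, 1)"

definition taylor_coeff ::
  "(real \<times> real \<times> real \<Rightarrow> real) \<Rightarrow> real \<times> real \<times> real \<Rightarrow> nat \<Rightarrow> nat \<Rightarrow> nat \<Rightarrow> real" where
  "taylor_coeff f p i j k =
     (partial_x ^^ i) ((partial_y ^^ j) ((partial_eps ^^ k) f)) p / (fact i * fact j * fact k)"

definition real_analytic_on ::
  "(real \<times> real \<times> real) set \<Rightarrow> (real \<times> real \<times> real \<Rightarrow> real) \<Rightarrow> bool" where
  "real_analytic_on U f \<longleftrightarrow> smooth_on U f \<and>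
     (\<forall>p\<in>U. \<forall>\<^sub>F q in nhds p.
        ((\<lambda>(i, j, k). taylor_coeff f p i j k * fst (q - p) ^ i *
            fst (snd (q - p)) ^ j * snd (snd (q - p)) ^ k) has_sum f q) UNIV)"

definition taylor_map :: "(real \<times> real \<times> real \<Rightarrow> real \<times> real) \<Rightarrow> formal_map" where
  "taylor_map f = (series3 (taylor_coeff (fst \<circ> f) 0), series3 (taylor_coeff (snd \<circ> f) 0))"

definition area_preserving_on ::
  "(real \<times> real \<times> real) set \<Rightarrow> (real \<times> real \<times> real \<Rightarrow> real \<times> real) \<Rightarrow> bool" where
  "area_preserving_on U f \<longleftrightarrow>
     (\<forall>p\<in>U. \<bar>partial_x (fst \<circ> f) p * partial_y (snd \<circ> f) p
            - partial_y (fst \<circ> f) p * partial_x (snd \<circ> f) p\<bar> = 1)"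

definition smooth_area_preserving_family ::
  "(real \<times> real \<times> real) set \<Rightarrow> (real \<times> real \<times> real \<Rightarrow> real \<times> real) \<Rightarrow> bool" where
  "smooth_area_preserving_family U f \<longleftrightarrow>
     open U \<and> 0 \<in> U \<and> smooth_on U (fst \<circ> f) \<and> smooth_on U (snd \<circ> f) \<and> area_preserving_on U f"

definition analytic_area_preserving_family ::
  "(real \<times> real \<times> real) set \<Rightarrow> (real \<times> real \<times> real \<Rightarrow> real \<times> real) \<Rightarrow> bool" where
  "analytic_area_preserving_family U f \<longleftrightarrow>
     open U \<and> 0 \<in> U \<and> real_analytic_on U (fst \<circ> f) \<and> real_analytic_on U (snd \<circ> f) \<and>
     area_preserving_on U f"

definition formal_area_preserving_family :: "formal_map \<Rightarrow> bool" where
  "formal_area_preserving_family F \<longleftrightarrow> jacobian F = 1 \<or> jacobian F = -1"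

end

theory Submission
  imports Defs
begin

text \<open>
  Give \<open>x, y, \<epsilon>\<close> the weights \<open>2, 3, 6\<close>. After a linear change of variables the linear part of
  \<open>F\<^sub>0\<close> is a Jordan block, and then \<open>F\<close> agrees to leading order in the weight with the
  time-one map of \<open>h\<^sub>6 = y\<^sup>2/2 + a x\<^sup>3\<close>. One looks for \<open>\<eta>\<close> and \<open>h\<close> with
  \<open>\<Phi>\<^sub>\<eta> \<circ> F = \<Phi>\<^sub>h \<circ> \<Phi>\<^sub>\<eta>\<close>, improving both by one weight at a time. Area preservation makes
  the leading error a Hamiltonian vector field with Hamiltonian \<open>r\<close>, and replacing \<open>\<eta>\<close> by \<open>\<eta> + d\<close>
  and \<open>h\<close> by \<open>h + e\<close> removes it when \<open>e = r + {d, h\<^sub>6}\<close>. This homological equation can be solved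
  with \<open>e\<close> independent of \<open>y\<close>, because \<open>{_, h\<^sub>6} = y \<partial>\<^sub>x - 3 a x\<^sup>2 \<partial>\<^sub>y\<close> reaches every
  monomial divisible by \<open>y\<close>, modulo monomials of the same weight and lower degree in \<open>y\<close>.
  For a smooth family, taking Taylor series commutes with products and derivatives, so the Jacobian
  of the Taylor series is again the constant \<open>\<plusminus>1\<close>.
\<close>

subsection \<open>Coefficients\<close>

text \<open>The weights make \<open>y^2\<close> and \<open>x^3\<close> equally heavy. A bracket
  costs 2 + 3 = 5, so a Hamiltonian of weight at least 6 raises weights by at least 1, and its
  exponential series is finite in each weight. Weight 6 for \<epsilon> turns
  \<open>k + 3 * m \<ge> 3\<close> into weight at least 6 and puts every \<epsilon>-term of the map
  beyond leading order. The obstacle: bracketing with \<open>y^2/2 + a x^3\<close> raises the weight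
  by exactly 1, so the correction \<open>d\<close> is one weight lighter than the error Hamiltonian
  \<open>r\<close>. Taken alone, \<open>d\<close> disturbs each side of the conjugacy more than the
  error it removes. These disturbances cancel up to a commutator; to see this, the map must be known
  modulo two extra weights, hence the coefficient of \<open>x^2\<close> in its second component.
  Maps are handled through the algebra automorphisms they induce by substitution, where flows become
  exponentials and commutators can be computed. The sign: for a nilpotent N the quadratic form det(N
  v, v) is semidefinite, so its sign cannot be chosen. As the coefficient of \<open>y^2\<close> is
  fixed to be positive, a reflection must be allowed.\<close>

lemma fps3_eqI: "(\<And>i j k. coeff3 f i j k = coeff3 g i j k) \<Longrightarrow> f = g"
  unfolding coeff3_def by (intro fps_ext) auto

lemma coeff3_series3 [simp]: "coeff3 (series3 c) i j k = c i j k"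
  by (simp add: coeff3_def series3_def)

lemma coeff3_0 [simp]: "coeff3 0 i j k = 0"
  by (simp add: coeff3_def)

lemma coeff3_1 [simp]: "coeff3 1 i j k = (if i = 0 \<and> j = 0 \<and> k = 0 then 1 else 0)"
  by (simp add: coeff3_def)

lemma coeff3_add [simp]: "coeff3 (f + g) i j k = coeff3 f i j k + coeff3 g i j k"
  by (simp add: coeff3_def)

lemma coeff3_diff [simp]: "coeff3 (f - g) i j k = coeff3 f i j k - coeff3 g i j k"
  by (simp add: coeff3_def)

lemma coeff3_uminus [simp]: "coeff3 (- f) i j k = - coeff3 f i j k"
  by (simp add: coeff3_def)

lemma coeff3_sum: "coeff3 (sum f S) i j k = (\<Sum>s\<in>S. coeff3 (f s) i j k)"
  by (induction S rule: infinite_finite_induct) simp_all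

lemma coeff3_const3 [simp]: "coeff3 (const3 c) i j k = (if i = 0 \<and> j = 0 \<and> k = 0 then c else 0)"
  by (simp add: coeff3_def const3_def)

lemma coeff3_const3_mult [simp]: "coeff3 (const3 c * f) i j k = c * coeff3 f i j k"
  by (simp add: coeff3_def const3_def)

lemma coeff3_mult:
  "coeff3 (f * g) a b c =
    (\<Sum>i=0..a. \<Sum>j=0..b. \<Sum>k=0..c. coeff3 f i j k * coeff3 g (a - i) (b - j) (c - k))"
  by (simp add: coeff3_def fps_mult_nth fps_sum_nth)

lemma coeff3_mult_000: "coeff3 (f * g) 0 0 0 = coeff3 f 0 0 0 * coeff3 g 0 0 0"
  by (simp add: coeff3_mult)

lemma coeff3_var_x_mult [simp]:
  "coeff3 (var_x * f) i j k = (if i = 0 then 0 else coeff3 f (i - 1) j k)"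
  by (simp add: coeff3_def var_x_def)

lemma coeff3_var_y_mult [simp]:
  "coeff3 (var_y * f) i j k = (if j = 0 then 0 else coeff3 f i (j - 1) k)"
  by (simp add: coeff3_def var_y_def)

lemma coeff3_var_eps_mult [simp]:
  "coeff3 (var_eps * f) i j k = (if k = 0 then 0 else coeff3 f i j (k - 1))"
  by (simp add: coeff3_def var_eps_def)

lemma coeff3_var_x: "coeff3 var_x i j k = (if i = 1 \<and> j = 0 \<and> k = 0 then 1 else 0)"
  using coeff3_var_x_mult[of 1 i j k] by auto

lemma coeff3_var_y: "coeff3 var_y i j k = (if i = 0 \<and> j = 1 \<and> k = 0 then 1 else 0)"
  using coeff3_var_y_mult[of 1 i j k] by auto

lemma coeff3_var_eps: "coeff3 var_eps i j k = (if i = 0 \<and> j = 0 \<and> k = 1 then 1 else 0)"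
  using coeff3_var_eps_mult[of 1 i j k] by auto

lemma const3_0 [simp]: "const3 0 = 0" and const3_1 [simp]: "const3 1 = 1"
  by (simp_all add: const3_def)

lemma const3_add: "const3 (a + b) = const3 a + const3 b"
  by (intro fps3_eqI) simp

lemma const3_uminus: "const3 (- a) = - const3 a"
  by (intro fps3_eqI) simp

lemma const3_mult: "const3 (a * b) = const3 a * const3 b"
  by (intro fps3_eqI) simp

lemma const3_sum: "const3 (sum f S) = (\<Sum>s\<in>S. const3 (f s))"
  by (intro fps3_eqI) (simp add: coeff3_sum)

definition monomial3 :: "real \<Rightarrow> nat \<Rightarrow> nat \<Rightarrow> nat \<Rightarrow> fps3" where
  "monomial3 c i j k = const3 c * (var_x ^ i * var_y ^ j * var_eps ^ k)"

lemma coeff3_monomial3: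
  "coeff3 (monomial3 c i j k) a b d = (if a = i \<and> b = j \<and> d = k then c else 0)"
proof -
  have e: "coeff3 (var_eps ^ k) a b d = (if a = 0 \<and> b = 0 \<and> d = k then 1 else 0)" for a b d k
    by (induction k arbitrary: d) auto
  have y: "coeff3 (var_y ^ j * var_eps ^ k) a b d = (if a = 0 \<and> b = j \<and> d = k then 1 else 0)"
    for a b d j k
    by (induction j arbitrary: b) (auto simp: e mult.assoc)
  have x: "coeff3 (var_x ^ i * (var_y ^ j * var_eps ^ k)) a b d
      = (if a = i \<and> b = j \<and> d = k then 1 else 0)" for a b d i j k
    by (induction i arbitrary: a) (auto simp: y mult.assoc)
  show ?thesis
    by (simp add: monomial3_def x mult.assoc)
qed

lemma monomial3_mult:
  "monomial3 c i j k * monomial3 c' i' j' k' = monomial3 (c * c') (i + i') (j + j') (k + k')"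
  by (simp add: monomial3_def const3_mult power_add algebra_simps)

subsection \<open>Derivatives and the Poisson bracket\<close>

lemma coeff3_deriv_x [simp]: "coeff3 (deriv_x f) i j k = real (i + 1) * coeff3 f (i + 1) j k"
proof -
  have "fps_nth (fps_nth (of_nat n * (g :: real fps fps)) j) k = of_nat n * fps_nth (fps_nth g j) k" for n g
    by (simp flip: fps_of_nat)
  from this[of "i+1" "fps_nth f (i+1)"] show ?thesis by (simp add: coeff3_def deriv_x_def)
qed

lemma coeff3_deriv_y [simp]: "coeff3 (deriv_y f) i j k = real (j + 1) * coeff3 f i (j + 1) k"
proof -
  have "fps_nth (of_nat n * (g :: real fps)) k = of_nat n * fps_nth g k" for n g
    by (simp flip: fps_of_nat)
  from this[of "j+1" "fps_nth (fps_nth f i) (j+1)"] show ?thesis by (simp add: coeff3_def deriv_y_def)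
qed

lemma deriv_x_add: "deriv_x (f + g) = deriv_x f + deriv_x g"
  by (intro fps3_eqI) (simp add: algebra_simps)

lemma deriv_y_add: "deriv_y (f + g) = deriv_y f + deriv_y g"
  by (intro fps3_eqI) (simp add: algebra_simps)

lemma deriv_x_diff: "deriv_x (f - g) = deriv_x f - deriv_x g"
  by (intro fps3_eqI) (simp add: algebra_simps)

lemma deriv_y_diff: "deriv_y (f - g) = deriv_y f - deriv_y g"
  by (intro fps3_eqI) (simp add: algebra_simps)

lemma deriv_x_mult: "deriv_x (f * g) = deriv_x f * g + f * deriv_x g"
  by (simp add: deriv_x_def)

lemma deriv_y_mult: "deriv_y (f * g) = deriv_y f * g + f * deriv_y g"
  by (intro fps_ext) (simp add: deriv_y_def fps_mult_nth fps_deriv_sum sum.distrib)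

lemma deriv_x_const3 [simp]: "deriv_x (const3 c) = 0"
  by (intro fps3_eqI) simp

lemma deriv_y_const3 [simp]: "deriv_y (const3 c) = 0"
  by (intro fps3_eqI) simp

lemma deriv_vars [simp]:
  "deriv_x var_x = 1" "deriv_x var_y = 0" "deriv_x var_eps = 0"
  "deriv_y var_x = 0" "deriv_y var_y = 1" "deriv_y var_eps = 0"
  by (intro fps3_eqI; auto simp: coeff3_var_x coeff3_var_y coeff3_var_eps)+

lemma deriv_xy_commute: "deriv_x (deriv_y f) = deriv_y (deriv_x f)"
  by (intro fps3_eqI) simp

lemma poisson_add_left: "poisson (f + f') g = poisson f g + poisson f' g"
  by (simp add: poisson_def deriv_x_add deriv_y_add algebra_simps)

lemma poisson_add_right: "poisson f (g + g') = poisson f g + poisson f g'"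
  by (simp add: poisson_def deriv_x_add deriv_y_add algebra_simps)

lemma poisson_diff_right: "poisson f (g - g') = poisson f g - poisson f g'"
  by (simp add: poisson_def deriv_x_diff deriv_y_diff algebra_simps)

lemma poisson_mult_left: "poisson (f * f') g = poisson f g * f' + f * poisson f' g"
  by (simp add: poisson_def deriv_x_mult deriv_y_mult algebra_simps)

lemma poisson_const3_mult_left: "poisson (const3 c * f) g = const3 c * poisson f g"
  by (simp add: poisson_mult_left) (simp add: poisson_def)

lemma poisson_anticommute: "poisson f g = - poisson g f"
  by (simp add: poisson_def)

lemma poisson_jacobi:
  "poisson (poisson f g) h = poisson (poisson f h) g + poisson f (poisson g h)"
  by (simp add: poisson_def deriv_x_diff deriv_y_diff deriv_x_mult deriv_y_mult
      deriv_xy_commute algebra_simps)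

lemma poisson_var [simp]:
  "poisson var_x f = deriv_y f" "poisson var_y f = - deriv_x f" "poisson var_eps f = 0"
  by (simp_all add: poisson_def)

lemma lie_op_add: "lie_op h (f + g) = lie_op h f + lie_op h g"
  by (simp add: lie_op_def poisson_add_left)

lemma lie_op_commutator:
  "lie_op f (lie_op g z) - lie_op g (lie_op f z) = lie_op (poisson g f) z"
  by (simp add: lie_op_def poisson_jacobi[of z g f])

subsection \<open>Weighted orders\<close>

text \<open>The weights are parameters because two gradings are in use: total degree (1, 1, 1)
  governs the truncation in \<open>subst3\<close>, while (2, 3, 6) governs the exponential and the
  induction.\<close>

definition order_ge :: "nat \<Rightarrow> nat \<Rightarrow> nat \<Rightarrow> nat \<Rightarrow> fps3 \<Rightarrow> bool" where
  "order_ge p q s N f \<longleftrightarrow> (\<forall>i j k. p * i + q * j + s * k < N \<longrightarrow> coeff3 f i j k = 0)"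

lemma order_geD: "order_ge p q s N f \<Longrightarrow> p * i + q * j + s * k < N \<Longrightarrow> coeff3 f i j k = 0"
  by (simp add: order_ge_def)

lemma order_ge_0 [simp]: "order_ge p q s 0 f"
  by (simp add: order_ge_def)

lemma order_ge_zero [simp]: "order_ge p q s N 0"
  by (simp add: order_ge_def)

lemma order_ge_mono: "order_ge p q s N f \<Longrightarrow> M \<le> N \<Longrightarrow> order_ge p q s M f"
  by (auto simp: order_ge_def)

lemma order_ge_add: "order_ge p q s N f \<Longrightarrow> order_ge p q s N g \<Longrightarrow> order_ge p q s N (f + g)"
  by (auto simp: order_ge_def)

lemma order_ge_diff: "order_ge p q s N f \<Longrightarrow> order_ge p q s N g \<Longrightarrow> order_ge p q s N (f - g)"
  by (auto simp: order_ge_def)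

lemma order_ge_uminus [simp]: "order_ge p q s N (- f) = order_ge p q s N f"
  by (auto simp: order_ge_def)

lemma order_ge_minus_commute: "order_ge p q s N (f - g) \<Longrightarrow> order_ge p q s N (g - f)"
  by (auto simp: order_ge_def)

lemma order_ge_trans:
  "order_ge p q s N (f - g) \<Longrightarrow> order_ge p q s N (g - h) \<Longrightarrow> order_ge p q s N (f - h)"
  using order_ge_add[of p q s N "f - g" "g - h"] by simp

lemma order_ge_sum: "(\<And>a. a \<in> A \<Longrightarrow> order_ge p q s N (f a)) \<Longrightarrow> order_ge p q s N (sum f A)"
  by (auto simp: order_ge_def coeff3_sum intro: sum.neutral)

lemma order_ge_const3_mult: "order_ge p q s N f \<Longrightarrow> order_ge p q s N (const3 c * f)"
  by (simp add: order_ge_def)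

lemma order_ge_mult:
  assumes "order_ge p q s N f" "order_ge p q s M g"
  shows "order_ge p q s (N + M) (f * g)"
  unfolding order_ge_def
proof (intro allI impI)
  fix a b c assume lt: "p * a + q * b + s * c < N + M"
  have "coeff3 f i j k * coeff3 g (a - i) (b - j) (c - k) = 0"
    if "i \<in> {0..a}" "j \<in> {0..b}" "k \<in> {0..c}" for i j k
  proof (cases "p * i + q * j + s * k < N")
    case True
    then show ?thesis using assms(1) by (simp add: order_ge_def)
  next
    case False
    have "p * a = p * i + p * (a - i)" "q * b = q * j + q * (b - j)" "s * c = s * k + s * (c - k)"
      using that by (simp_all flip: distrib_left)
    with False lt have "p * (a - i) + q * (b - j) + s * (c - k) < M" by linarith
    then show ?thesis using assms(2) by (simp add: order_ge_def)
  qed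
  then show "coeff3 (f * g) a b c = 0"
    unfolding coeff3_mult by (intro sum.neutral ballI) auto
qed

lemma order_ge_mult_left: "order_ge p q s N f \<Longrightarrow> order_ge p q s N (f * g)"
  using order_ge_mult[of p q s N f 0 g] by simp

lemma order_ge_mult_right: "order_ge p q s N g \<Longrightarrow> order_ge p q s N (f * g)"
  using order_ge_mult[of p q s 0 f N g] by simp

lemma order_ge_power: "order_ge p q s N f \<Longrightarrow> order_ge p q s (n * N) (f ^ n)"
  by (induction n) (auto intro: order_ge_mult)

lemma order_ge_vars [simp]:
  "order_ge p q s p var_x" "order_ge p q s q var_y" "order_ge p q s s var_eps"
  by (auto simp: order_ge_def coeff3_var_x coeff3_var_y coeff3_var_eps)

lemma order_ge_deriv_x: "order_ge p q s N f \<Longrightarrow> order_ge p q s (N - p) (deriv_x f)"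
  by (auto simp: order_ge_def algebra_simps)

lemma order_ge_deriv_y: "order_ge p q s N f \<Longrightarrow> order_ge p q s (N - q) (deriv_y f)"
  by (auto simp: order_ge_def algebra_simps)

lemma order_ge_poisson:
  assumes "order_ge p q s N f" "order_ge p q s M g"
  shows "order_ge p q s (N + M - (p + q)) (poisson f g)"
proof -
  have "order_ge p q s (N - p + (M - q)) (deriv_x f * deriv_y g)"
    "order_ge p q s (N - q + (M - p)) (deriv_y f * deriv_x g)"
    using assms by (auto intro: order_ge_mult order_ge_deriv_x order_ge_deriv_y)
  then show ?thesis unfolding poisson_def
    by (intro order_ge_diff) (erule order_ge_mono; linarith)+
qed

lemma order_ge_unweighted: "order_ge 1 1 1 N f \<Longrightarrow> 0 < p \<Longrightarrow> 0 < q \<Longrightarrow> 0 < s \<Longrightarrow> order_ge p q s N f"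
proof (unfold order_ge_def, intro allI impI)
  fix i j k assume f: "\<forall>i j k. 1 * i + 1 * j + 1 * k < N \<longrightarrow> coeff3 f i j k = 0"
    and pos: "0 < p" "0 < q" "0 < s" and lt: "p * i + q * j + s * k < N"
  have "i \<le> p * i" "j \<le> q * j" "k \<le> s * k" using pos by auto
  then have "1 * i + 1 * j + 1 * k < N" using lt by linarith
  then show "coeff3 f i j k = 0" using f by blast
qed

text \<open>With \<open>order_ge_unweighted\<close>, this shows that all positive weights define the
  same topology, so continuity may be checked in whichever grading is convenient.\<close>

lemma order_ge_weighted:
  assumes "0 < p" "order_ge p q s (max p (max q s) * N) f"
  shows "order_ge 1 1 1 N f"
  unfolding order_ge_def
proof (intro allI impI)
  fix i j k assume lt: "1 * i + 1 * j + 1 * k < N"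
  let ?m = "max p (max q s)"
  have "p * i + q * j + s * k \<le> ?m * i + ?m * j + ?m * k"
    by (intro add_mono mult_right_mono) auto
  also have "\<dots> = ?m * (i + j + k)" by (simp only: distrib_left)
  also have "\<dots> < ?m * N" using lt assms(1) by (intro mult_strict_left_mono) auto
  finally show "coeff3 f i j k = 0" using assms(2) by (rule order_geD[rotated])
qed

lemma order_ge_all_imp_zero:
  assumes "0 < p" "0 < q" "0 < s" "\<And>N. order_ge p q s N f" shows "f = 0"
proof (intro fps3_eqI)
  fix i j k
  show "coeff3 f i j k = coeff3 0 i j k"
    using order_geD[OF assms(4), of i j k "Suc (p * i + q * j + s * k)"] by simp
qed

subsection \<open>Continuous additive operators\<close>

text \<open>Continuity at 0 in the adic topology. Identities between such operators need only be
  checked on monomials, which is how the rules for substitution are proved.\<close>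

definition continuous_additive :: "(fps3 \<Rightarrow> fps3) \<Rightarrow> bool" where
  "continuous_additive T \<longleftrightarrow> (\<forall>f g. T (f + g) = T f + T g) \<and>
     (\<forall>N. \<exists>M. \<forall>f. order_ge 1 1 1 M f \<longrightarrow> order_ge 1 1 1 N (T f))"

lemma additive_zero:
  fixes T :: "fps3 \<Rightarrow> fps3"
  assumes "\<And>f g. T (f + g) = T f + T g"
  shows "T 0 = 0"
  using assms[of 0 0] by simp

lemma additive_diff:
  fixes T :: "fps3 \<Rightarrow> fps3"
  assumes "\<And>f g. T (f + g) = T f + T g"
  shows "T (f - g) = T f - T g"
  using assms[of "f - g" g] by (simp add: algebra_simps)

lemma additive_sum: "(\<And>f g. T (f + g) = T f + T g) \<Longrightarrow> T (\<Sum>a\<in>A. f a) = (\<Sum>a\<in>A. T (f a) :: fps3)"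
  for f :: "'a \<Rightarrow> fps3"
  by (induction A rule: infinite_finite_induct) (auto simp: additive_zero)

lemma continuous_additive_order:
  assumes add: "\<And>f g. T (f + g) = T f + T g" and pos: "0 < p" "0 < q" "0 < s"
    and cont: "\<And>N f. order_ge p q s (N + d) f \<Longrightarrow> order_ge p q s N (T f)"
  shows "continuous_additive T"
  unfolding continuous_additive_def
proof (intro conjI allI)
  fix N
  let ?M = "max p (max q s) * N"
  have "order_ge 1 1 1 N (T f)" if "order_ge 1 1 1 (?M + d) f" for f
    using order_ge_weighted[OF pos(1) cont[OF order_ge_unweighted[OF that pos]]] .
  then show "\<exists>M. \<forall>f. order_ge 1 1 1 M f \<longrightarrow> order_ge 1 1 1 N (T f)" by blast
qed (rule add)

lemma continuous_additive_compose:
  assumes "continuous_additive S" "continuous_additive T"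
  shows "continuous_additive (\<lambda>f. S (T f))"
  unfolding continuous_additive_def
proof (intro conjI allI)
  fix N
  obtain K where "\<forall>f. order_ge 1 1 1 K f \<longrightarrow> order_ge 1 1 1 N (S f)"
    using assms unfolding continuous_additive_def by blast
  moreover obtain M where "\<forall>f. order_ge 1 1 1 M f \<longrightarrow> order_ge 1 1 1 K (T f)"
    using assms unfolding continuous_additive_def by blast
  ultimately show "\<exists>M. \<forall>f. order_ge 1 1 1 M f \<longrightarrow> order_ge 1 1 1 N (S (T f))"
    by blast
qed (use assms in \<open>simp add: continuous_additive_def\<close>)

lemma continuous_additive_add:
  assumes "continuous_additive S" "continuous_additive T"
  shows "continuous_additive (\<lambda>f. S f + T f)"
  unfolding continuous_additive_def
proof (intro conjI allI)
  fix N
  obtain M M' where "\<forall>f. order_ge 1 1 1 M f \<longrightarrow> order_ge 1 1 1 N (S f)"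
    "\<forall>f. order_ge 1 1 1 M' f \<longrightarrow> order_ge 1 1 1 N (T f)"
    using assms unfolding continuous_additive_def by blast
  then show "\<exists>M. \<forall>f. order_ge 1 1 1 M f \<longrightarrow> order_ge 1 1 1 N (S f + T f)"
    by (intro exI[of _ "max M M'"] allI impI order_ge_add)
      (blast intro: order_ge_mono max.cobounded1 max.cobounded2)+
qed (use assms in \<open>simp add: continuous_additive_def\<close>)

lemma continuous_additive_mult:
  "continuous_additive (\<lambda>f. f * g)" "continuous_additive (\<lambda>f. g * f)"
  by (rule continuous_additive_order[of _ 1 1 1 0];
      auto simp: algebra_simps intro: order_ge_mult_left order_ge_mult_right)+

lemma continuous_additive_deriv: "continuous_additive deriv_x" "continuous_additive deriv_y"
  by (rule continuous_additive_order[of _ 1 1 1 1];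
      force simp: deriv_x_add deriv_y_add dest: order_ge_deriv_x order_ge_deriv_y)+

lemma finite_degree_le: "finite {(i :: nat, j :: nat, k :: nat). i + j + k \<le> N}"
  by (rule finite_subset[of _ "{..N} \<times> {..N} \<times> {..N}"]) auto

lemma polynomial_approximation:
  "order_ge 1 1 1 (Suc N) (f - (\<Sum>(i, j, k)\<in>{(i, j, k). i + j + k \<le> N}. monomial3 (coeff3 f i j k) i j k))"
  unfolding order_ge_def
proof (intro allI impI)
  fix a b c assume lt: "1 * a + 1 * b + 1 * c < Suc N"
  have "(\<Sum>(i, j, k)\<in>{(i, j, k). i + j + k \<le> N}. coeff3 (monomial3 (coeff3 f i j k) i j k) a b c)
      = (\<Sum>t\<in>{(i, j, k). i + j + k \<le> N}. if t = (a, b, c) then coeff3 f a b c else 0)"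
    by (intro sum.cong) (auto simp: coeff3_monomial3 split: if_splits)
  also have "\<dots> = coeff3 f a b c"
    using lt by (subst sum.delta) (auto simp: finite_degree_le)
  finally show "coeff3 (f - (\<Sum>(i, j, k)\<in>{(i, j, k). i + j + k \<le> N}. monomial3 (coeff3 f i j k) i j k)) a b c = 0"
    by (simp add: coeff3_sum case_prod_unfold)
qed

text \<open>Both operators agree on Taylor polynomials, and continuity makes the contribution of the
  remainder arbitrarily small. Since the monomials carry arbitrary real coefficients, additivity
  suffices in place of linearity.\<close>

lemma continuous_additive_eqI:
  assumes S: "continuous_additive S" and T: "continuous_additive T"
    and eq: "\<And>c i j k. S (monomial3 c i j k) = T (monomial3 c i j k)"
  shows "S f = T f"
proof -
  have "order_ge 1 1 1 N (S f - T f)" for N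
  proof -
    obtain M M' where M: "\<forall>f. order_ge 1 1 1 M f \<longrightarrow> order_ge 1 1 1 N (S f)"
      "\<forall>f. order_ge 1 1 1 M' f \<longrightarrow> order_ge 1 1 1 N (T f)"
      using S T unfolding continuous_additive_def by blast
    define P where "P = (\<Sum>(i, j, k)\<in>{(i, j, k). i + j + k \<le> max M M'}. monomial3 (coeff3 f i j k) i j k)"
    have add: "S (f + g) = S f + S g" "T (f + g) = T f + T g" for f g
      using S T by (auto simp: continuous_additive_def)
    have "S P = T P"
      unfolding P_def by (simp add: additive_sum[OF add(1)] additive_sum[OF add(2)] eq case_prod_unfold)
    then have "S f - T f = S (f - P) - T (f - P)"
      by (simp add: additive_diff[OF add(1)] additive_diff[OF add(2)])
    moreover have "order_ge 1 1 1 M (f - P)" "order_ge 1 1 1 M' (f - P)"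
      unfolding P_def by (rule order_ge_mono[OF polynomial_approximation]; simp)+
    ultimately show ?thesis using M by (auto intro: order_ge_diff)
  qed
  then have "S f - T f = 0" by (intro order_ge_all_imp_zero[of 1 1 1]) auto
  then show ?thesis by simp
qed

subsection \<open>Substitution\<close>

lemma coeff3_zero_iff_order: "coeff3 f 0 0 0 = 0 \<longleftrightarrow> order_ge 1 1 1 1 f"
  by (auto simp: order_ge_def)

lemma order_ge_monomial_value:
  assumes "order_ge p q s P g" "order_ge p q s Q h"
  shows "order_ge p q s (i * P + j * Q + k * s) (g ^ i * h ^ j * var_eps ^ k)"
  using assms by (intro order_ge_mult order_ge_power) auto

lemma subst3_add: "subst3 (f + g) G = subst3 f G + subst3 g G"
  by (intro fps3_eqI) (simp add: subst3_def case_prod_unfold algebra_simps sum.distrib)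

lemma subst3_diff: "subst3 (f - g) G = subst3 f G - subst3 g G"
  by (rule additive_diff[of "\<lambda>f. subst3 f G"]) (rule subst3_add)

lemma order_ge_subst3:
  assumes "order_ge p q s N f" "order_ge p q s p (fst G)" "order_ge p q s q (snd G)"
  shows "order_ge p q s N (subst3 f G)"
  unfolding order_ge_def
proof (intro allI impI)
  fix a b c assume lt: "p * a + q * b + s * c < N"
  have "coeff3 f i j k * coeff3 (fst G ^ i * snd G ^ j * var_eps ^ k) a b c = 0" for i j k
  proof (cases "p * i + q * j + s * k < N")
    case False
    with lt show ?thesis
      using order_geD[OF order_ge_monomial_value[OF assms(2,3), of i j k], of a b c]
      by (simp add: mult.commute)
  qed (use assms(1) in \<open>simp add: order_ge_def\<close>)
  then show "coeff3 (subst3 f G) a b c = 0"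
    unfolding subst3_def coeff3_series3 by (intro sum.neutral) auto
qed

lemma continuous_additive_subst3:
  assumes "fixes_origin G"
  shows "continuous_additive (\<lambda>f. subst3 f G)"
proof -
  have "order_ge 1 1 1 1 (fst G)" "order_ge 1 1 1 1 (snd G)"
    using assms unfolding fixes_origin_def coeff3_zero_iff_order by blast+
  then show ?thesis
    by (intro continuous_additive_order[of _ 1 1 1 0]) (auto intro: order_ge_subst3 subst3_add)
qed

lemma subst3_monomial3:
  assumes "fixes_origin G"
  shows "subst3 (monomial3 c i j k) G = const3 c * (fst G ^ i * snd G ^ j * var_eps ^ k)"
proof (intro fps3_eqI)
  fix a b d
  have o: "order_ge 1 1 1 1 (fst G)" "order_ge 1 1 1 1 (snd G)"
    using assms unfolding fixes_origin_def coeff3_zero_iff_order by blast+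
  have "coeff3 (subst3 (monomial3 c i j k) G) a b d =
      (\<Sum>t\<in>{(i, j, k). i + j + k \<le> a + b + d}. if t = (i, j, k)
         then c * coeff3 (fst G ^ i * snd G ^ j * var_eps ^ k) a b d else 0)"
    unfolding subst3_def coeff3_series3
    by (intro sum.cong) (auto simp: coeff3_monomial3 split: if_splits)
  \<comment> \<open>If the index lies outside the truncated range, the coefficient on the right
    vanishes as well, because the product has order at least \<open>i + j + k\<close>.\<close>
  also have "\<dots> = c * coeff3 (fst G ^ i * snd G ^ j * var_eps ^ k) a b d"
    using order_geD[OF order_ge_monomial_value[OF o, of i j k], of a b d]
    by (subst sum.delta) (auto simp: finite_degree_le)
  finally show "coeff3 (subst3 (monomial3 c i j k) G) a b d =
      coeff3 (const3 c * (fst G ^ i * snd G ^ j * var_eps ^ k)) a b d" by simp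
qed

lemma subst3_mult:
  assumes G: "fixes_origin G"
  shows "subst3 (f * g) G = subst3 f G * subst3 g G"
proof -
  note cs = continuous_additive_subst3[OF G]
  note cm = continuous_additive_compose[OF cs continuous_additive_mult(1)]
    continuous_additive_compose[OF cs continuous_additive_mult(2)]
    continuous_additive_compose[OF continuous_additive_mult(1) cs]
    continuous_additive_compose[OF continuous_additive_mult(2) cs]
  \<comment> \<open>Density is used once per factor: here \<open>g\<close> becomes arbitrary while
    \<open>f\<close> is still a monomial.\<close>
  have "subst3 (monomial3 c i j k * g) G = subst3 (monomial3 c i j k) G * subst3 g G" for c i j k g
    by (rule continuous_additive_eqI[OF cm(2) cm(4)])
      (simp add: monomial3_mult subst3_monomial3 G const3_mult power_add algebra_simps)
  then show ?thesis
    by (rule continuous_additive_eqI[OF cm(1) cm(3)])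
qed

lemma subst3_const3 [simp]: "fixes_origin G \<Longrightarrow> subst3 (const3 c) G = const3 c"
  using subst3_monomial3[of G c 0 0 0] by (simp add: monomial3_def)

lemma subst3_1 [simp]: "fixes_origin G \<Longrightarrow> subst3 1 G = 1"
  using subst3_const3[of G 1] by simp

lemma subst3_vars [simp]:
  assumes "fixes_origin G"
  shows "subst3 var_x G = fst G" "subst3 var_y G = snd G" "subst3 var_eps G = var_eps"
  using subst3_monomial3[OF assms, of 1 1 0 0] subst3_monomial3[OF assms, of 1 0 1 0]
    subst3_monomial3[OF assms, of 1 0 0 1] by (simp_all add: monomial3_def)

lemma subst3_power: "fixes_origin G \<Longrightarrow> subst3 (f ^ n) G = subst3 f G ^ n"
  by (induction n) (simp_all add: subst3_mult)

lemma subst3_formal_id: "subst3 f formal_id = f"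
proof -
  have o: "fixes_origin formal_id"
    by (simp add: fixes_origin_def formal_id_def coeff3_var_x coeff3_var_y)
  have "continuous_additive (\<lambda>f. f)"
    by (rule continuous_additive_order[of _ 1 1 1 0]) auto
  then show ?thesis
    by (rule continuous_additive_eqI[OF continuous_additive_subst3[OF o]])
      (simp only: subst3_monomial3[OF o], simp add: formal_id_def monomial3_def)
qed

lemma coeff3_subst3_000: "coeff3 (subst3 f G) 0 0 0 = coeff3 f 0 0 0"
proof -
  have "{(i, j, k). i + j + k \<le> (0 :: nat)} = {(0, 0, 0)}" by auto
  then show ?thesis by (simp add: subst3_def)
qed

lemma fixes_origin_formal_comp: "fixes_origin F \<Longrightarrow> fixes_origin (F \<circ>\<^sub>f G)"
  by (simp add: fixes_origin_def formal_comp_def coeff3_subst3_000)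

lemma formal_comp_sel [simp]:
  "fst (F \<circ>\<^sub>f G) = subst3 (fst F) G" "snd (F \<circ>\<^sub>f G) = subst3 (snd F) G"
  by (simp_all add: formal_comp_def)

lemma subst3_formal_comp:
  assumes "fixes_origin G" "fixes_origin H"
  shows "subst3 f (G \<circ>\<^sub>f H) = subst3 (subst3 f G) H"
proof (rule continuous_additive_eqI[where f = f])
  show "continuous_additive (\<lambda>f. subst3 f (G \<circ>\<^sub>f H))"
    by (intro continuous_additive_subst3 fixes_origin_formal_comp assms)
  show "continuous_additive (\<lambda>f. subst3 (subst3 f G) H)"
    using assms by (intro continuous_additive_compose[OF continuous_additive_subst3 continuous_additive_subst3])
  show "subst3 (monomial3 c i j k) (G \<circ>\<^sub>f H) = subst3 (subst3 (monomial3 c i j k) G) H" for c i j k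
    using assms by (simp add: subst3_monomial3 fixes_origin_formal_comp subst3_mult subst3_power)
qed

lemma formal_comp_assoc:
  assumes "fixes_origin G" "fixes_origin H"
  shows "(F \<circ>\<^sub>f G) \<circ>\<^sub>f H = F \<circ>\<^sub>f (G \<circ>\<^sub>f H)"
  using subst3_formal_comp[OF assms] by (simp add: formal_comp_def)

lemma formal_id_comp: "fixes_origin F \<Longrightarrow> formal_id \<circ>\<^sub>f F = F"
  by (simp add: formal_comp_def formal_id_def)

section \<open>The chain rule and the Jacobian of a composition\<close>

lemma deriv_x_power: "deriv_x (f ^ n) = of_nat n * f ^ (n - 1) * deriv_x f"
proof (induction n)
  case 0
  then show ?case using deriv_x_const3[of 1] by simp
next
  case (Suc n)
  then show ?case by (cases n) (auto simp: deriv_x_mult algebra_simps)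
qed

lemma deriv_y_power: "deriv_y (f ^ n) = of_nat n * f ^ (n - 1) * deriv_y f"
proof (induction n)
  case 0
  then show ?case using deriv_y_const3[of 1] by simp
next
  case (Suc n)
  then show ?case by (cases n) (auto simp: deriv_y_mult algebra_simps)
qed

lemma subst3_of_nat: "fixes_origin G \<Longrightarrow> subst3 (of_nat n) G = of_nat n"
  by (induction n) (use subst3_const3[of G 0] in \<open>simp_all add: subst3_add\<close>)

lemma deriv_subst3:
  assumes G: "fixes_origin G"
  shows "deriv_x (subst3 f G) = subst3 (deriv_x f) G * deriv_x (fst G) + subst3 (deriv_y f) G * deriv_x (snd G)"
    and "deriv_y (subst3 f G) = subst3 (deriv_x f) G * deriv_y (fst G) + subst3 (deriv_y f) G * deriv_y (snd G)"
proof -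
  have ds: "continuous_additive (\<lambda>f. subst3 (deriv_x f) G)" "continuous_additive (\<lambda>f. subst3 (deriv_y f) G)"
    and sd: "continuous_additive (\<lambda>f. deriv_x (subst3 f G))" "continuous_additive (\<lambda>f. deriv_y (subst3 f G))"
    using continuous_additive_compose[OF continuous_additive_subst3[OF G]]
      continuous_additive_compose[OF _ continuous_additive_subst3[OF G]] continuous_additive_deriv
    by blast+
  have dsm: "continuous_additive (\<lambda>f. subst3 (deriv_x f) G * g + subst3 (deriv_y f) G * h)" for g h
    by (intro continuous_additive_add continuous_additive_compose[OF continuous_additive_mult(1)] ds)
  have [simp]: "deriv_x (var_eps ^ n) = 0" "deriv_y (var_eps ^ n) = 0" for n
    by (simp_all add: deriv_x_power deriv_y_power)
  have m: "subst3 (deriv_x (monomial3 c i j k)) G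
      = const3 c * (of_nat i * fst G ^ (i - 1) * snd G ^ j * var_eps ^ k)"
    "subst3 (deriv_y (monomial3 c i j k)) G
      = const3 c * (of_nat j * fst G ^ i * snd G ^ (j - 1) * var_eps ^ k)" for c i j k
    by (simp_all add: monomial3_def deriv_x_mult deriv_y_mult deriv_x_power deriv_y_power subst3_mult subst3_of_nat
        subst3_power G)
  show "deriv_x (subst3 f G) = subst3 (deriv_x f) G * deriv_x (fst G) + subst3 (deriv_y f) G * deriv_x (snd G)"
    by (rule continuous_additive_eqI[OF sd(1) dsm])
      (simp add: m subst3_monomial3 G deriv_x_mult deriv_x_power deriv_y_power, simp add: algebra_simps)
  show "deriv_y (subst3 f G) = subst3 (deriv_x f) G * deriv_y (fst G) + subst3 (deriv_y f) G * deriv_y (snd G)"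
    by (rule continuous_additive_eqI[OF sd(2) dsm])
      (simp add: m subst3_monomial3 G deriv_y_mult deriv_x_power deriv_y_power, simp add: algebra_simps)
qed

text \<open>In dimension two the bracket is a Jacobian determinant, so the chain rule gives this
  factor. When the Jacobian is 1, substitution preserves brackets.\<close>

lemma poisson_subst3:
  assumes G: "fixes_origin G"
  shows "poisson (subst3 f G) (subst3 g G) = subst3 (poisson f g) G * jacobian G"
  unfolding poisson_def jacobian_def deriv_subst3[OF G] subst3_diff subst3_mult[OF G]
  by (simp add: algebra_simps)

lemma jacobian_eq_poisson: "jacobian F = poisson (fst F) (snd F)"
  by (simp add: jacobian_def poisson_def)

lemma jacobian_formal_comp:
  "fixes_origin G \<Longrightarrow> jacobian (F \<circ>\<^sub>f G) = subst3 (jacobian F) G * jacobian G"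
  by (simp add: jacobian_eq_poisson formal_comp_def poisson_subst3)

subsection \<open>The exponential of a Hamiltonian vector field\<close>

abbreviation wt_ge :: "nat \<Rightarrow> fps3 \<Rightarrow> bool" where
  "wt_ge \<equiv> order_ge 2 3 6"

lemma wt_ge_eqI: "(\<And>N. wt_ge N (f - g)) \<Longrightarrow> f = g"
  using order_ge_all_imp_zero[of 2 3 6 "f - g"] by simp

lemma wt_ge_lie_op: "wt_ge (5 + p) h \<Longrightarrow> wt_ge w g \<Longrightarrow> wt_ge (w + p) (lie_op h g)"
  using order_ge_poisson[of 2 3 6 w g "5 + p" h] by (simp add: lie_op_def)

lemma lie_op_const3_mult: "lie_op h (const3 c * g) = const3 c * lie_op h g"
  by (simp add: lie_op_def poisson_const3_mult_left)

lemma lie_op_uminus: "lie_op (- h) g = - lie_op h g"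
  using poisson_diff_right[of g 0 h] poisson_diff_right[of g 0 0] by (simp add: lie_op_def)

lemma lie_op_add_ham: "lie_op (h + h') g = lie_op h g + lie_op h' g"
  by (simp add: lie_op_def poisson_add_right)

lemma lie_op_diff: "lie_op h (f - g) = lie_op h f - lie_op h g"
  by (rule additive_diff[OF lie_op_add])

lemma lie_op_sum: "lie_op h (\<Sum>a\<in>A. f a) = (\<Sum>a\<in>A. lie_op h (f a))"
  by (rule additive_sum[OF lie_op_add])

text \<open>The factorial is built in so that the Leibniz formula for these terms is a plain
  convolution without binomial coefficients.\<close>

definition lie_term :: "fps3 \<Rightarrow> nat \<Rightarrow> fps3 \<Rightarrow> fps3" where
  "lie_term h n g = const3 (1 / fact n) * (lie_op h ^^ n) g"

lemma lie_term_0 [simp]: "lie_term h 0 g = g"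
  by (simp add: lie_term_def)

lemma lie_term_1 [simp]: "lie_term h (Suc 0) g = lie_op h g"
  by (simp add: lie_term_def)

lemma lie_term_Suc: "const3 (real (Suc n)) * lie_term h (Suc n) g = lie_op h (lie_term h n g)"
proof -
  have "real (Suc n) * (1 / fact (Suc n)) = 1 / fact n"
    by (subst fact_Suc) (simp del: of_nat_Suc)
  then show ?thesis
    by (simp add: lie_term_def lie_op_const3_mult mult.assoc[symmetric] flip: const3_mult)
qed

lemma lie_op_power_add: "(lie_op h ^^ n) (f + g) = (lie_op h ^^ n) f + (lie_op h ^^ n) g"
  by (induction n) (simp_all add: lie_op_add)

lemma lie_term_add: "lie_term h n (f + g) = lie_term h n f + lie_term h n g"
  by (simp add: lie_term_def lie_op_power_add algebra_simps)

lemma lie_term_sum: "lie_term h n (\<Sum>a\<in>A. f a) = (\<Sum>a\<in>A. lie_term h n (f a))"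
  by (rule additive_sum[OF lie_term_add])

lemma wt_ge_lie_op_power: "wt_ge 6 h \<Longrightarrow> wt_ge w g \<Longrightarrow> wt_ge (w + n) ((lie_op h ^^ n) g)"
proof (induction n)
  case (Suc n)
  then show ?case using wt_ge_lie_op[of 1 h "w + n"] by simp
qed simp

lemma wt_ge_lie_term: "wt_ge 6 h \<Longrightarrow> wt_ge w g \<Longrightarrow> wt_ge (w + n) (lie_term h n g)"
  by (simp add: lie_term_def order_ge_const3_mult wt_ge_lie_op_power)

text \<open>The term of index \<open>n\<close> has weight at least \<open>n\<close>, so the infinite
  sum stops before the bound \<open>N\<close>.\<close>

lemma coeff3_lie_exp:
  assumes h: "wt_ge 6 h" and N: "2 * a + 3 * b + 6 * c < N"
  shows "coeff3 (lie_exp h g) a b c = (\<Sum>n<N. coeff3 (lie_term h n g) a b c)"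
proof -
  have "coeff3 (lie_exp h g) a b c = (\<Sum>n. coeff3 (lie_term h n g) a b c)"
    by (simp add: lie_exp_def lie_term_def)
  also have "\<dots> = (\<Sum>n<N. coeff3 (lie_term h n g) a b c)"
  proof (rule suminf_finite)
    fix n assume "n \<notin> {..<N}"
    with N show "coeff3 (lie_term h n g) a b c = 0"
      using order_geD[OF wt_ge_lie_term[OF h order_ge_0, of n g]] by simp
  qed simp
  finally show ?thesis .
qed

lemma lie_exp_truncation:
  assumes h: "wt_ge 6 h" and g: "wt_ge w g"
  shows "wt_ge (w + N) (lie_exp h g - (\<Sum>n<N. lie_term h n g))"
proof -
  have "wt_ge (w + N) (lie_exp h g - (\<Sum>n<w + N. lie_term h n g))"
    by (simp add: order_ge_def coeff3_lie_exp[OF h, where N = "w + N"] coeff3_sum)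
  moreover have "(\<Sum>n<w + N. lie_term h n g) - (\<Sum>n<N. lie_term h n g) = (\<Sum>n=N..<w + N. lie_term h n g)"
    using sum_diff_nat_ivl[of 0 N "w + N" "\<lambda>n. lie_term h n g"] by (simp add: atLeast0LessThan)
  moreover have "wt_ge (w + N) (\<Sum>n=N..<w + N. lie_term h n g)"
    by (intro order_ge_sum order_ge_mono[OF wt_ge_lie_term[OF h g]]) auto
  ultimately show ?thesis
    using order_ge_trans[of 2 3 6 "w + N" "lie_exp h g" "\<Sum>n<w + N. lie_term h n g" "\<Sum>n<N. lie_term h n g"]
    by simp
qed

lemma lie_exp_truncation_0:
  "wt_ge 6 h \<Longrightarrow> wt_ge N (lie_exp h g - (\<Sum>n<N. lie_term h n g))"
  using lie_exp_truncation[of h 0 g N] by simp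

lemma wt_ge_lie_exp: "wt_ge 6 h \<Longrightarrow> wt_ge w g \<Longrightarrow> wt_ge w (lie_exp h g)"
  using lie_exp_truncation[of h w g 0] by simp

lemma wt_ge_lie_exp_diff: "wt_ge 6 h \<Longrightarrow> wt_ge w g \<Longrightarrow> wt_ge (w + 1) (lie_exp h g - g)"
  using lie_exp_truncation[of h w g 1] by simp

lemma wt_ge_lie_exp_diff2:
  "wt_ge 6 h \<Longrightarrow> wt_ge w g \<Longrightarrow> wt_ge (w + 2) (lie_exp h g - g - lie_op h g)"
  using lie_exp_truncation[of h w g 2] by (simp add: numeral_2_eq_2 algebra_simps)

lemma lie_exp_add: "wt_ge 6 h \<Longrightarrow> lie_exp h (f + g) = lie_exp h f + lie_exp h g"
  by (intro fps3_eqI) (simp add: coeff3_lie_exp[OF _ lessI] lie_term_add sum.distrib)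

lemma lie_exp_diff: "wt_ge 6 h \<Longrightarrow> lie_exp h (f - g) = lie_exp h f - lie_exp h g"
  by (rule additive_diff) (rule lie_exp_add)

lemma continuous_additive_lie_exp: "wt_ge 6 h \<Longrightarrow> continuous_additive (lie_exp h)"
  by (rule continuous_additive_order[of _ 2 3 6 0]) (auto simp: lie_exp_add intro: wt_ge_lie_exp)

text \<open>The operation \<open>m\<close> is abstract because the formula is needed both for the
  product and for the Poisson bracket; on each of them \<open>lie_op h\<close> acts as a
  derivation.\<close>

lemma lie_term_bilinear:
  fixes m :: "fps3 \<Rightarrow> fps3 \<Rightarrow> fps3"
  assumes scale: "\<And>c f g. m (const3 c * f) g = const3 c * m f g"
      "\<And>c f g. m f (const3 c * g) = const3 c * m f g"
    and deriv: "\<And>f g. lie_op h (m f g) = m (lie_op h f) g + m f (lie_op h g)"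
  shows "lie_term h n (m f g) = (\<Sum>k\<le>n. m (lie_term h k f) (lie_term h (n - k) g))"
proof (induction n)
  case (Suc n)
  define a where "a k = m (lie_term h k f) (lie_term h (Suc n - k) g)" for k
  have 1: "m (lie_op h (lie_term h k f)) (lie_term h (n - k) g) = const3 (real (Suc k)) * a (Suc k)" for k
    by (simp add: a_def scale flip: lie_term_Suc)
  have 2: "m (lie_term h k f) (lie_op h (lie_term h (n - k) g)) = const3 (real (Suc n - k)) * a k"
    if "k \<le> n" for k
    using that by (simp add: a_def scale Suc_diff_le flip: lie_term_Suc)
  have "const3 (real (Suc n)) * lie_term h (Suc n) (m f g) =
      (\<Sum>k\<le>n. const3 (real (Suc k)) * a (Suc k)) + (\<Sum>k\<le>n. const3 (real (Suc n - k)) * a k)"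
    unfolding lie_term_Suc Suc.IH lie_op_sum deriv sum.distrib
    by (intro arg_cong2[of _ _ _ _ "(+)"] sum.cong refl) (simp_all only: 1 2 atMost_iff)
  \<comment> \<open>Both ranges are extended by a vanishing term: the first sum at
    \<open>k = 0\<close>, the second at \<open>k = Suc n\<close>.\<close>
  also have "\<dots> = (\<Sum>k\<le>Suc n. const3 (real k) * a k) + (\<Sum>k\<le>Suc n. const3 (real (Suc n - k)) * a k)"
    unfolding sum.atMost_Suc_shift[of "\<lambda>k. const3 (real k) * a k" n] by simp
  also have "\<dots> = (\<Sum>k\<le>Suc n. const3 (real (Suc n)) * a k)"
    unfolding sum.distrib[symmetric]
    by (intro sum.cong refl) (simp flip: const3_add distrib_right of_nat_add)
  finally have "const3 (real (Suc n)) * lie_term h (Suc n) (m f g) = const3 (real (Suc n)) * (\<Sum>k\<le>Suc n. a k)"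
    by (simp only: sum_distrib_left)
  moreover have "const3 (1 / real (Suc n)) * (const3 (real (Suc n)) * x) = x" for x
    by (simp add: mult.assoc[symmetric] del: of_nat_Suc flip: const3_mult)
  ultimately show ?case unfolding a_def by metis
qed simp

text \<open>A Cauchy product computed modulo each weight. The 5 in the weight assumption is the cost
  of a Poisson bracket, and the cutoff \<open>M = N + 5\<close> makes up for it.\<close>

lemma lie_exp_bilinear:
  fixes m :: "fps3 \<Rightarrow> fps3 \<Rightarrow> fps3"
  assumes h: "wt_ge 6 h"
    and add: "\<And>f f' g. m (f + f') g = m f g + m f' g" "\<And>f g g'. m f (g + g') = m f g + m f g'"
    and scale: "\<And>c f g. m (const3 c * f) g = const3 c * m f g"
      "\<And>c f g. m f (const3 c * g) = const3 c * m f g"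
    and deriv: "\<And>f g. lie_op h (m f g) = m (lie_op h f) g + m f (lie_op h g)"
    and ord: "\<And>i j f g. wt_ge i f \<Longrightarrow> wt_ge j g \<Longrightarrow> wt_ge (i + j - 5) (m f g)"
  shows "lie_exp h (m f g) = m (lie_exp h f) (lie_exp h g)"
proof (rule wt_ge_eqI)
  fix N :: nat
  define M where "M = N + 5"
  define A where "A k l = m (lie_term h k f) (lie_term h l g)" for k l
  define F G where "F = (\<Sum>k<M. lie_term h k f)" and "G = (\<Sum>k<M. lie_term h k g)"
  have suml: "m (\<Sum>a\<in>S. u a) v = (\<Sum>a\<in>S. m (u a) v)" for u v and S :: "nat set"
    by (rule additive_sum[of "\<lambda>u. m u v"]) (rule add)
  have sumr: "m v (\<Sum>a\<in>S. u a) = (\<Sum>a\<in>S. m v (u a))" for u v and S :: "nat set"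
    by (rule additive_sum[of "\<lambda>u. m v u"]) (rule add)
  have "m (lie_exp h f - F) (lie_exp h g) + m F (lie_exp h g - G) = m (lie_exp h f) (lie_exp h g) - m F G"
    using add(1)[of "lie_exp h f - F" F] add(2)[of F "lie_exp h g - G" G] by simp
  moreover have "wt_ge (M + 0 - 5) (m (lie_exp h f - F) (lie_exp h g))" "wt_ge (0 + M - 5) (m F (lie_exp h g - G))"
    unfolding F_def G_def by (intro ord lie_exp_truncation_0 h order_ge_0)+
  ultimately have 1: "wt_ge N (m (lie_exp h f) (lie_exp h g) - m F G)"
    using order_ge_add[of 2 3 6 N "m (lie_exp h f - F) (lie_exp h g)" "m F (lie_exp h g - G)"]
    by (simp add: M_def)
  have 2: "wt_ge N (lie_exp h (m f g) - (\<Sum>n<M. \<Sum>k\<le>n. A k (n - k)))"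
    unfolding A_def lie_term_bilinear[of m, OF scale deriv, symmetric]
    by (rule order_ge_mono[OF lie_exp_truncation_0[OF h]]) (simp add: M_def)
  have tri: "(\<Sum>n<M. \<Sum>k\<le>n. A k (n - k)) = (\<Sum>(k, l)\<in>{(k, l). k + l < M}. A k l)"
    by (rule sum.triangle_reindex[symmetric])
  have "m F G = (\<Sum>(k, l)\<in>{..<M} \<times> {..<M}. A k l)"
    unfolding F_def suml by (simp add: G_def sumr A_def sum.cartesian_product)
  \<comment> \<open>What separates the square from the triangle has \<open>k + l \<ge> M\<close>,
    hence weight at least \<open>N\<close>.\<close>
  also have "\<dots> - (\<Sum>(k, l)\<in>{(k, l). k + l < M}. A k l) =
      (\<Sum>(k, l)\<in>{..<M} \<times> {..<M} - {(k, l). k + l < M}. A k l)"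
    by (rule sum_diff[symmetric]) auto
  finally have "m F G - (\<Sum>n<M. \<Sum>k\<le>n. A k (n - k)) =
      (\<Sum>(k, l)\<in>{..<M} \<times> {..<M} - {(k, l). k + l < M}. A k l)"
    by (simp add: tri)
  moreover have "wt_ge N (\<Sum>(k, l)\<in>{..<M} \<times> {..<M} - {(k, l). k + l < M}. A k l)"
  proof (rule order_ge_sum, unfold split_paired_all prod.case)
    fix k l assume "(k, l) \<in> {..<M} \<times> {..<M} - {(k, l). k + l < M}"
    then show "wt_ge N (A k l)"
      unfolding A_def M_def
      by (intro order_ge_mono[OF ord[OF wt_ge_lie_term[OF h order_ge_0] wt_ge_lie_term[OF h order_ge_0]]])
        auto
  qed
  ultimately have "wt_ge N (m F G - (\<Sum>n<M. \<Sum>k\<le>n. A k (n - k)))" by simp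
  from order_ge_minus_commute[OF order_ge_trans[OF 1 order_ge_trans[OF this order_ge_minus_commute[OF 2]]]]
  show "wt_ge N (lie_exp h (m f g) - m (lie_exp h f) (lie_exp h g))" .
qed

lemma lie_exp_mult:
  assumes "wt_ge 6 h" shows "lie_exp h (f * g) = lie_exp h f * lie_exp h g"
proof (rule lie_exp_bilinear[OF assms])
  show "wt_ge (i + j - 5) (f * g)" if "wt_ge i f" "wt_ge j g" for i j f g
    using order_ge_mult[OF that] by (rule order_ge_mono) simp
qed (simp_all add: lie_op_def poisson_mult_left algebra_simps)

text \<open>The derivation property required here is the Jacobi identity. Applied to the two
  coordinates, the result says that flows preserve area.\<close>

lemma lie_exp_poisson:
  assumes "wt_ge 6 h" shows "lie_exp h (poisson f g) = poisson (lie_exp h f) (lie_exp h g)"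
proof (rule lie_exp_bilinear[OF assms])
  show "wt_ge (i + j - 5) (poisson f g)" if "wt_ge i f" "wt_ge j g" for i j f g
    using order_ge_poisson[OF that] by simp
  show "poisson f (const3 c * g) = const3 c * poisson f g" for c f g
    using poisson_anticommute[of f g] poisson_anticommute[of f "const3 c * g"]
    by (simp add: poisson_const3_mult_left)
  show "lie_op h (poisson f g) = poisson (lie_op h f) g + poisson f (lie_op h g)" for f g
    unfolding lie_op_def by (rule poisson_jacobi)
qed (simp_all add: lie_op_def poisson_add_left poisson_add_right poisson_const3_mult_left)

lemma lie_exp_eq_self:
  assumes "wt_ge 6 h" "lie_op h g = 0" shows "lie_exp h g = g"
proof (rule wt_ge_eqI)
  fix N
  have z: "lie_op h 0 = 0"
    by (rule additive_zero[OF lie_op_add])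
  have "(lie_op h ^^ Suc n) g = 0" for n
    using z by (induction n) (simp_all add: assms(2))
  then have "lie_term h (Suc n) g = 0" for n
    unfolding lie_term_def by simp
  then have "(\<Sum>n<Suc N. lie_term h n g) = g"
    by (subst sum.lessThan_Suc_shift) simp
  then show "wt_ge N (lie_exp h g - g)"
    using order_ge_mono[OF lie_exp_truncation_0[OF assms(1), of "Suc N" g], of N] by simp
qed

lemma lie_exp_const3 [simp]: "wt_ge 6 h \<Longrightarrow> lie_exp h (const3 c) = const3 c"
  by (rule lie_exp_eq_self) (simp_all add: lie_op_def poisson_def)

lemma lie_exp_var_eps [simp]: "wt_ge 6 h \<Longrightarrow> lie_exp h var_eps = var_eps"
  by (rule lie_exp_eq_self) (simp_all add: lie_op_def)

lemma lie_exp_power: "wt_ge 6 h \<Longrightarrow> lie_exp h (f ^ n) = lie_exp h f ^ n"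
  using lie_exp_const3[of h 1] by (induction n) (simp_all add: lie_exp_mult)

section \<open>Time-one maps as substitutions\<close>

lemma wt_ge_time_one_map:
  assumes "wt_ge 6 h"
  shows "wt_ge 2 (fst (time_one_map h))" "wt_ge 3 (snd (time_one_map h))"
  using assms by (simp_all add: time_one_map_def wt_ge_lie_exp)

lemma wt_ge_fixes_origin: "wt_ge 2 (fst G) \<Longrightarrow> wt_ge 3 (snd G) \<Longrightarrow> fixes_origin G"
  by (simp add: order_ge_def fixes_origin_def)

lemma fixes_origin_time_one_map: "wt_ge 6 h \<Longrightarrow> fixes_origin (time_one_map h)"
  by (rule wt_ge_fixes_origin) (rule wt_ge_time_one_map; assumption)+

text \<open>Both sides are continuous ring homomorphisms that agree on the variables. Composition of
  flows thus becomes composition of exponentials in the reverse order.\<close>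

lemma subst3_time_one_map:
  assumes h: "wt_ge 6 h"
  shows "subst3 f (time_one_map h) = lie_exp h f"
proof (rule continuous_additive_eqI[where f = f])
  note o = fixes_origin_time_one_map[OF h]
  show "continuous_additive (\<lambda>f. subst3 f (time_one_map h))"
    by (rule continuous_additive_subst3[OF o])
  show "continuous_additive (lie_exp h)"
    by (rule continuous_additive_lie_exp[OF h])
  show "subst3 (monomial3 c i j k) (time_one_map h) = lie_exp h (monomial3 c i j k)" for c i j k
    using h o by (simp add: subst3_monomial3)
      (simp add: monomial3_def lie_exp_mult lie_exp_power time_one_map_def)
qed

lemma jacobian_time_one_map: "wt_ge 6 h \<Longrightarrow> jacobian (time_one_map h) = 1"
  using lie_exp_poisson[of h var_x var_y] lie_exp_const3[of h 1]
  by (simp add: jacobian_eq_poisson time_one_map_def)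

lemma lie_term_uminus: "lie_term (- h) n f = const3 ((- 1) ^ n) * lie_term h n f"
proof -
  have "(lie_op (- h) ^^ n) f = const3 ((- 1) ^ n) * (lie_op h ^^ n) f"
    by (induction n) (simp_all add: lie_op_uminus lie_op_const3_mult const3_uminus)
  then show ?thesis by (simp add: lie_term_def algebra_simps)
qed

lemma lie_term_lie_term:
  "lie_term h k (const3 c * lie_term h l f) = const3 (c / (fact k * fact l)) * (lie_op h ^^ (k + l)) f"
proof -
  have s: "(lie_op h ^^ k) (const3 c * g) = const3 c * (lie_op h ^^ k) g" for c g
    by (induction k) (simp_all add: lie_op_const3_mult)
  show ?thesis
    by (simp add: lie_term_def s funpow_add mult.assoc[symmetric] flip: const3_mult)
qed

text \<open>On each diagonal \<open>k + l = n\<close> the double series collects the alternating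
  binomial sum, which is zero unless \<open>n = 0\<close>.\<close>

lemma lie_exp_inverse:
  assumes h: "wt_ge 6 h"
  shows "lie_exp h (lie_exp (- h) f) = f"
proof (rule wt_ge_eqI)
  fix N
  \<comment> \<open>The successor keeps the diagonal \<open>n = 0\<close>, which yields
    \<open>f\<close>, inside the triangle even for \<open>N = 0\<close>.\<close>
  define M where "M = Suc N"
  have h': "wt_ge 6 (- h)" using h by simp
  define S where "S = (\<Sum>l<M. lie_term (- h) l f)"
  define A where "A k l = lie_term h k (lie_term (- h) l f)" for k l
  have "wt_ge M (lie_exp h (lie_exp (- h) f) - lie_exp h S)"
    using wt_ge_lie_exp[OF h lie_exp_truncation_0[OF h']] by (simp add: S_def lie_exp_diff[OF h])
  moreover have "wt_ge M (lie_exp h S - (\<Sum>k<M. lie_term h k S))"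
    by (rule lie_exp_truncation_0[OF h])
  ultimately have 1: "wt_ge M (lie_exp h (lie_exp (- h) f) - (\<Sum>k<M. lie_term h k S))"
    by (rule order_ge_trans)
  have "(\<Sum>k<M. lie_term h k S) = (\<Sum>(k, l)\<in>{..<M} \<times> {..<M}. A k l)"
    by (simp add: S_def A_def lie_term_sum sum.cartesian_product)
  also have "\<dots> - (\<Sum>(k, l)\<in>{(k, l). k + l < M}. A k l) =
      (\<Sum>(k, l)\<in>{..<M} \<times> {..<M} - {(k, l). k + l < M}. A k l)"
    by (rule sum_diff[symmetric]) auto
  also have "wt_ge M \<dots>"
  proof (rule order_ge_sum, unfold split_paired_all prod.case)
    fix k l assume "(k, l) \<in> {..<M} \<times> {..<M} - {(k, l). k + l < M}"
    then show "wt_ge M (A k l)"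
      unfolding A_def
      by (intro order_ge_mono[OF wt_ge_lie_term[OF h wt_ge_lie_term[OF h' order_ge_0]]]) auto
  qed
  finally have 2: "wt_ge M ((\<Sum>k<M. lie_term h k S) - (\<Sum>(k, l)\<in>{(k, l). k + l < M}. A k l))" .
  have A: "A k l = const3 ((- 1) ^ l / (fact k * fact l)) * (lie_op h ^^ (k + l)) f" for k l
    by (simp add: A_def lie_term_uminus lie_term_lie_term)
  have "(\<Sum>k\<le>n. A k (n - k)) = (if n = 0 then f else 0)" for n
  proof (cases "n = 0")
    case False
    have "(\<Sum>k\<le>n. (- 1) ^ (n - k) / (fact k * fact (n - k)) :: real)
        = (\<Sum>k\<le>n. (- 1) ^ k / (fact (n - k) * fact k))"
      by (rule sum.reindex_bij_witness[of _ "\<lambda>k. n - k" "\<lambda>k. n - k"]) auto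
    also have "\<dots> = (\<Sum>k\<le>n. (- 1) ^ k * of_nat (n choose k)) / fact n"
      by (simp add: sum_divide_distrib binomial_fact mult.commute)
    also have "\<dots> = 0" using choose_alternating_sum[of n, where ?'a = real] False by simp
    finally have "(\<Sum>k\<le>n. (- 1) ^ (n - k) / (fact k * fact (n - k)) :: real) = 0" .
    moreover have "(\<Sum>k\<le>n. A k (n - k)) =
        const3 (\<Sum>k\<le>n. (- 1) ^ (n - k) / (fact k * fact (n - k))) * (lie_op h ^^ n) f"
      by (simp add: A const3_sum sum_distrib_right)
    ultimately show ?thesis using False by simp
  qed (simp add: A)
  then have "(\<Sum>(k, l)\<in>{(k, l). k + l < M}. A k l) = f"
    unfolding sum.triangle_reindex M_def by (simp add: sum.lessThan_Suc_shift)
  with order_ge_trans[OF 1 2] have "wt_ge M (lie_exp h (lie_exp (- h) f) - f)"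
    by simp
  then show "wt_ge N (lie_exp h (lie_exp (- h) f) - f)"
    unfolding M_def by (rule order_ge_mono) simp
qed

text \<open>In the difference of the series, every term other than \<open>lie_op d g\<close>
  contains \<open>d\<close> and at least one further operator, and each operator raises the
  weight.\<close>

lemma lie_exp_perturbation:
  assumes h: "wt_ge 6 h" and d: "wt_ge (5 + q) d" and q: "1 \<le> q" and g: "wt_ge w g"
  shows "wt_ge (w + q + 1) (lie_exp (h + d) g - lie_exp h g - lie_op d g)"
proof -
  have "wt_ge 6 d" by (rule order_ge_mono[OF d]) (use q in simp)
  with h have h': "wt_ge 6 (h + d)" by (rule order_ge_add)
  have pow: "wt_ge (w + q + n) ((lie_op (h + d) ^^ Suc n) g - (lie_op h ^^ Suc n) g)" for n
  proof (induction n)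
    case 0
    then show ?case using wt_ge_lie_op[OF d g] by (simp add: lie_op_add_ham)
  next
    case (Suc n)
    \<comment> \<open>Telescoping for noncommuting operators: A A^n - B B^n = A (A^n - B^n) + (A -
      B) B^n.\<close>
    have "(lie_op (h + d) ^^ Suc (Suc n)) g - (lie_op h ^^ Suc (Suc n)) g =
        lie_op (h + d) ((lie_op (h + d) ^^ Suc n) g - (lie_op h ^^ Suc n) g)
          + lie_op d ((lie_op h ^^ Suc n) g)"
      by (simp add: lie_op_diff lie_op_add_ham)
    moreover have 1: "wt_ge (w + q + n + 1) (lie_op (h + d) ((lie_op (h + d) ^^ Suc n) g - (lie_op h ^^ Suc n) g))"
      by (rule wt_ge_lie_op[OF _ Suc]) (use h' in simp)
    have 2: "wt_ge (w + Suc n + q) (lie_op d ((lie_op h ^^ Suc n) g))"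
      by (rule wt_ge_lie_op[OF d wt_ge_lie_op_power[OF h g]])
    have "wt_ge (w + q + Suc n) (lie_op (h + d) ((lie_op (h + d) ^^ Suc n) g - (lie_op h ^^ Suc n) g)
          + lie_op d ((lie_op h ^^ Suc n) g))"
      by (intro order_ge_add order_ge_mono[OF 1] order_ge_mono[OF 2]) simp_all
    ultimately show ?case by (simp only:)
  qed
  \<comment> \<open>With \<open>q + 1\<close> terms the tails of both exponentials already have
    weight \<open>w + q + 1\<close>.\<close>
  let ?s = "\<lambda>h. \<Sum>n<q + 1. lie_term h n g"
  have "?s (h + d) - ?s h - lie_op d g
      = (\<Sum>n<q + 1. lie_term (h + d) n g - lie_term h n g - (if n = 1 then lie_op d g else 0))"
    using q by (simp add: sum_subtractf)
  moreover have "wt_ge (w + q + 1) (lie_term (h + d) n g - lie_term h n g - (if n = 1 then lie_op d g else 0))" for n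
  proof (cases n)
    case (Suc m)
    show ?thesis
    proof (cases m)
      case 0
      then show ?thesis using Suc by (simp add: lie_op_add_ham)
    next
      case (Suc l)
      have "wt_ge (w + q + 1) (const3 (1 / fact n) * ((lie_op (h + d) ^^ Suc m) g - (lie_op h ^^ Suc m) g))"
        by (intro order_ge_const3_mult order_ge_mono[OF pow]) (use Suc in simp)
      then show ?thesis using \<open>n = Suc m\<close> Suc by (simp add: lie_term_def right_diff_distrib)
    qed
  qed simp
  ultimately have s: "wt_ge (w + q + 1) (?s (h + d) - ?s h - lie_op d g)"
    by (simp only: order_ge_sum)
  have t: "wt_ge (w + q + 1) (lie_exp f g - ?s f)" if "wt_ge 6 f" for f
    using lie_exp_truncation[OF that g, of "q + 1"] by (simp only: add.assoc)
  from order_ge_add[OF order_ge_diff[OF t[OF h'] t[OF h]] s] show ?thesis by (simp add: algebra_simps)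
qed

lemma lie_exp_perturbation0:
  assumes h: "wt_ge 6 h" "wt_ge 6 h'" and d: "wt_ge (5 + q) (h - h')" and q: "1 \<le> q" and g: "wt_ge w g"
  shows "wt_ge (w + q) (lie_exp h g - lie_exp h' g)"
proof -
  have "wt_ge (w + q + 1) (lie_exp h g - lie_exp h' g - lie_op (h - h') g)"
    using lie_exp_perturbation[OF h(2) d q g] by simp
  then have "wt_ge (w + q) (lie_exp h g - lie_exp h' g - lie_op (h - h') g)"
    by (rule order_ge_mono) simp
  from order_ge_add[OF this wt_ge_lie_op[OF d g]] show ?thesis by simp
qed

subsection \<open>The homological equation\<close>

definition leading_ham :: "real \<Rightarrow> fps3" where
  "leading_ham a = const3 (1 / 2) * var_y ^ 2 + const3 a * var_x ^ 3"

lemma leading_ham_monomials: "leading_ham a = monomial3 (1 / 2) 0 2 0 + monomial3 a 3 0 0"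
  by (simp add: leading_ham_def monomial3_def)

lemma wt_ge_leading_ham: "wt_ge 6 (leading_ham a)"
  by (auto simp: leading_ham_monomials order_ge_def coeff3_monomial3)

lemma deriv_leading_ham:
  "deriv_x (leading_ham a) = const3 (3 * a) * var_x ^ 2" "deriv_y (leading_ham a) = var_y"
proof -
  have "const3 3 = 3" "const3 2 = 2"
    using const3_add[of 1 2] const3_add[of 1 1] by simp_all
  then have "const3 a * 3 = const3 (3 * a)" "const3 (1 / 2) * 2 = 1"
    using const3_mult[of 3 a] const3_mult[of "1 / 2" 2] by simp_all
  then show "deriv_x (leading_ham a) = const3 (3 * a) * var_x ^ 2" "deriv_y (leading_ham a) = var_y"
    by (simp_all add: leading_ham_def deriv_x_add deriv_y_add deriv_x_mult deriv_y_mult deriv_x_power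
        deriv_y_power algebra_simps flip: mult.assoc)
qed

text \<open>Cancelling the coefficient of \<open>x^i y^(j+1)\<close> in
  \<open>r + poisson \<eta> (leading_ham a)\<close> reads \<open>(i+1) \<eta>(i+1, j) - 3a (j+2)
  \<eta>(i-2, j+2) + r(i, j+1) = 0\<close>. It is solved for the term of highest degree in
  \<open>x\<close>, and \<eta> is normalised to vanish at \<open>x = 0\<close>.\<close>

fun homological_solution :: "real \<Rightarrow> fps3 \<Rightarrow> nat \<Rightarrow> nat \<Rightarrow> nat \<Rightarrow> real" where
  "homological_solution a r 0 j k = 0"
| "homological_solution a r (Suc i) j k =
    ((if i < 2 then 0 else 3 * a * real (j + 2) * homological_solution a r (i - 2) (j + 2) k)
      - coeff3 r i (Suc j) k) / real (Suc i)"

text \<open>The positions \<open>(i+1, j)\<close> and \<open>(i-2, j+2)\<close> have the same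
  weight, and \<open>(i, j+1)\<close> has one more; this is the loss of 1.\<close>

lemma homological_solution_eq_0:
  assumes r: "wt_ge w r"
  shows "2 * i + 3 * j + 6 * k < w - 1 \<Longrightarrow> homological_solution a r i j k = 0"
proof (induction i arbitrary: j rule: less_induct)
  case (less i)
  show ?case
  proof (cases i)
    case (Suc l)
    have "coeff3 r l (Suc j) k = 0" using less.prems Suc by (intro order_geD[OF r]) simp
    moreover have "homological_solution a r (l - 2) (j + 2) k = 0" if "\<not> l < 2"
      using less.prems Suc that by (intro less.IH) auto
    ultimately show ?thesis by (simp add: Suc)
  qed simp
qed

lemma homological_equation:
  assumes r: "wt_ge w r" and "1 \<le> w"
  obtains \<eta> where "wt_ge (w - 1) \<eta>" "wt_ge w (r + poisson \<eta> (leading_ham a))"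
    "\<And>i j k. j \<noteq> 0 \<Longrightarrow> coeff3 (r + poisson \<eta> (leading_ham a)) i j k = 0"
proof
  define \<eta> where "\<eta> = series3 (homological_solution a r)"
  show \<eta>: "wt_ge (w - 1) \<eta>"
    using homological_solution_eq_0[OF r] by (simp add: order_ge_def \<eta>_def)
  show "wt_ge w (r + poisson \<eta> (leading_ham a))"
    using order_ge_poisson[OF \<eta> wt_ge_leading_ham[of a]] \<open>1 \<le> w\<close> by (intro order_ge_add r) simp
  fix i j k :: nat assume "j \<noteq> 0"
  then obtain l where j: "j = Suc l" by (cases j) auto
  have p: "poisson \<eta> (leading_ham a) =
      var_y * deriv_x \<eta> - const3 (3 * a) * (var_x * (var_x * deriv_y \<eta>))"
    by (simp add: poisson_def deriv_leading_ham power2_eq_square algebra_simps)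
  have c: "coeff3 \<eta> i j k = homological_solution a r i j k" for i j k
    by (simp add: \<eta>_def)
  have "coeff3 (poisson \<eta> (leading_ham a)) i (Suc l) k =
      real (Suc i) * coeff3 \<eta> (Suc i) l k
        - (if i < 2 then 0 else 3 * a * (real (l + 2) * coeff3 \<eta> (i - 2) (l + 2) k))"
    by (auto simp: p numeral_2_eq_2 less_Suc_eq)
  then have "coeff3 (poisson \<eta> (leading_ham a)) i (Suc l) k = - coeff3 r i (Suc l) k"
    unfolding c homological_solution.simps by (cases "i < 2") (simp_all del: of_nat_Suc)
  then show "coeff3 (r + poisson \<eta> (leading_ham a)) i j k = 0"
    by (simp add: j)
qed

text \<open>Poincare lemma for a vector field whose divergence is small but not exactly zero.\<close>

lemma approximate_hamiltonian:
  assumes a: "wt_ge (2 + p) a" and b: "wt_ge (3 + p) b"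
    and div: "wt_ge (2 * p) (deriv_x a + deriv_y b)" and p: "1 \<le> p"
  obtains r where "wt_ge (5 + p) r" "deriv_y r = a" "wt_ge (4 + p) (deriv_x r + b)"
proof
  \<comment> \<open>The series \<open>a\<close> is integrated in \<open>y\<close>, with the
    integration constant taken from \<open>- b\<close> on the line \<open>y = 0\<close>. So the
    first component is matched exactly and the second only at \<open>y = 0\<close>.\<close>
  define r where "r = series3 (\<lambda>i j k. if j = 0 then (if i = 0 then 0 else - coeff3 b (i - 1) 0 k / real i)
      else coeff3 a i (j - 1) k / real j)"
  show "wt_ge (5 + p) r"
    unfolding order_ge_def
  proof (intro allI impI)
    fix i j k :: nat assume "2 * i + 3 * j + 6 * k < 5 + p"
    then show "coeff3 r i j k = 0"
      by (cases i; cases j) (auto simp: r_def intro!: order_geD[OF a] order_geD[OF b])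
  qed
  show "deriv_y r = a"
    by (intro fps3_eqI) (simp add: r_def)
  show "wt_ge (4 + p) (deriv_x r + b)"
    unfolding order_ge_def
  proof (intro allI impI)
    fix i j k :: nat assume lt: "2 * i + 3 * j + 6 * k < 4 + p"
    show "coeff3 (deriv_x r + b) i j k = 0"
    proof (cases j)
      case (Suc l)
      \<comment> \<open>Off \<open>y = 0\<close> the defect is the divergence integrated in
        \<open>y\<close>. Its index has weight below \<open>1 + p\<close>, and
        \<open>1 + p \<le> 2 * p\<close>.\<close>
      have "coeff3 (deriv_x a + deriv_y b) i l k = 0"
        using lt Suc p by (intro order_geD[OF div]) simp
      then show ?thesis by (simp add: r_def Suc field_simps)
    qed (simp add: r_def)
  qed
qed

subsection \<open>Substitution of nearby maps\<close>

lemma order_ge_power_diff: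
  assumes "order_ge p q s N f" "order_ge p q s N g" "order_ge p q s (N + e) (f - g)"
  shows "order_ge p q s (n * N + e) (f ^ n - g ^ n)"
proof (induction n)
  case (Suc n)
  have "order_ge p q s (N + (n * N + e)) (f * (f ^ n - g ^ n))"
    by (rule order_ge_mult[OF assms(1) Suc])
  moreover have "order_ge p q s (N + e + n * N) ((f - g) * g ^ n)"
    by (rule order_ge_mult[OF assms(3) order_ge_power[OF assms(2)]])
  ultimately have "order_ge p q s (Suc n * N + e) (f * (f ^ n - g ^ n) + (f - g) * g ^ n)"
    by (intro order_ge_add) (simp_all add: ac_simps)
  then show ?case by (simp add: algebra_simps)
qed simp

text \<open>Exchanging the factors of a monomial one at a time, each exchange gains the excess
  \<open>e\<close> over the weight of the monomial.\<close>

lemma order_ge_subst3_diff: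
  assumes G: "order_ge p q s p (fst G)" "order_ge p q s q (snd G)"
    and H: "order_ge p q s p (fst H)" "order_ge p q s q (snd H)"
    and d: "order_ge p q s (p + e) (fst G - fst H)" "order_ge p q s (q + e) (snd G - snd H)"
    and f: "order_ge p q s N f"
  shows "order_ge p q s (N + e) (subst3 f G - subst3 f H)"
  unfolding order_ge_def
proof (intro allI impI)
  fix a b c assume lt: "p * a + q * b + s * c < N + e"
  let ?v = "\<lambda>G i j k. fst G ^ i * snd G ^ j * var_eps ^ k"
  have eq: "coeff3 f i j k * coeff3 (?v G i j k) a b c = coeff3 f i j k * coeff3 (?v H i j k) a b c" for i j k
  proof (cases "p * i + q * j + s * k < N")
    case False
    have "order_ge p q s (i * p + e + j * q + k * s) ((fst G ^ i - fst H ^ i) * snd G ^ j * var_eps ^ k)"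
      by (intro order_ge_mult order_ge_power order_ge_power_diff G H d order_ge_vars)
    moreover have "order_ge p q s (i * p + (j * q + e) + k * s) (fst H ^ i * (snd G ^ j - snd H ^ j) * var_eps ^ k)"
      by (intro order_ge_mult order_ge_power order_ge_power_diff G H d order_ge_vars)
    ultimately have "order_ge p q s (i * p + j * q + k * s + e)
      ((fst G ^ i - fst H ^ i) * snd G ^ j * var_eps ^ k + fst H ^ i * (snd G ^ j - snd H ^ j) * var_eps ^ k)"
      by (intro order_ge_add) (simp_all add: ac_simps)
    then have "order_ge p q s (i * p + j * q + k * s + e) (?v G i j k - ?v H i j k)"
      by (simp add: algebra_simps)
    from order_geD[OF this, of a b c] show ?thesis using lt False by (simp add: mult.commute)
  qed (use order_geD[OF f] in simp)
  have "coeff3 (subst3 f G) a b c = coeff3 (subst3 f H) a b c"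
    unfolding subst3_def coeff3_series3 by (intro sum.cong refl) (auto simp: eq)
  then show "coeff3 (subst3 f G - subst3 f H) a b c = 0" by simp
qed

subsection \<open>Completeness\<close>

lemma wt_ge_limit:
  assumes step: "\<And>n. wt_ge (n + c) (f (Suc n) - f n)" and c: "0 < c"
  obtains g where "\<And>n. wt_ge (n + c) (g - f n)"
proof
  fix n
  have tail: "wt_ge (n + c) (f m - f n)" if "n \<le> m" for n m
    using that
  proof (induction m rule: dec_induct)
    case (step m)
    have "wt_ge (n + c) (f (Suc m) - f m)" by (rule order_ge_mono[OF assms(1)]) (use step in simp)
    then show ?case using step by (blast intro: order_ge_trans)
  qed simp
  \<comment> \<open>A coefficient of weight \<open>m\<close> no longer changes from
    \<open>f m\<close> on, since later increments have weight at least \<open>m + c\<close> and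
    \<open>c\<close> is positive.\<close>
  define g where "g = series3 (\<lambda>i j k. coeff3 (f (2 * i + 3 * j + 6 * k)) i j k)"
  show "wt_ge (n + c) (g - f n)"
    unfolding order_ge_def
  proof (intro allI impI)
    fix i j k :: nat assume lt: "2 * i + 3 * j + 6 * k < n + c"
    let ?m = "2 * i + 3 * j + 6 * k"
    show "coeff3 (g - f n) i j k = 0"
    proof (cases "n \<le> ?m")
      case True
      from order_geD[OF tail[OF this] lt] show ?thesis by (simp add: g_def)
    next
      case False
      then have "coeff3 (f n - f ?m) i j k = 0" using c by (intro order_geD[OF tail[of ?m n]]) auto
      then show ?thesis by (simp add: g_def)
    qed
  qed
qed

subsection \<open>Normal form of a map with unipotent linear part\<close>

lemma lie_exp_inverse': "wt_ge 6 h \<Longrightarrow> lie_exp (- h) (lie_exp h f) = f"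
  using lie_exp_inverse[of "- h" f] by simp

text \<open>The map agrees with the time-one map of \<open>leading_ham a\<close> up to excess 2 over
  the weights 2 and 3 of the coordinates: that Hamiltonian has velocity
  \<open>(y, -3 a x^2)\<close>.\<close>

locale normalised_map =
  fixes F :: formal_map and a :: real
  assumes jacobian_F: "jacobian F = 1"
    and fst_F: "wt_ge 4 (fst F - var_x - var_y)"
    and snd_F: "wt_ge 5 (snd F - var_y + const3 (3 * a) * var_x ^ 2)"
begin

abbreviation h\<^sub>6 :: fps3 where "h\<^sub>6 \<equiv> leading_ham a"

lemma wt_ge_F: "wt_ge 2 (fst F)" "wt_ge 3 (snd F)"
proof -
  have "wt_ge 2 ((fst F - var_x - var_y) + (var_x + var_y))"
    by (intro order_ge_add order_ge_mono[OF fst_F] order_ge_vars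
        order_ge_mono[OF order_ge_vars(2)]) simp_all
  then show "wt_ge 2 (fst F)" by simp
  have "wt_ge 3 ((snd F - var_y + const3 (3 * a) * var_x ^ 2) + (var_y - const3 (3 * a) * var_x ^ 2))"
    by (intro order_ge_add order_ge_diff order_ge_const3_mult order_ge_mono[OF snd_F] order_ge_vars
        order_ge_mono[OF order_ge_power[OF order_ge_vars(1)]]) simp_all
  then show "wt_ge 3 (snd F)" by simp
qed

lemma origin_F: "fixes_origin F"
  by (rule wt_ge_fixes_origin) (rule wt_ge_F)+

lemma wt_ge_subst3_F: "wt_ge w g \<Longrightarrow> wt_ge w (subst3 g F)"
  by (intro order_ge_subst3 wt_ge_F)

lemma subst3_F_leading:
  assumes g: "wt_ge w g"
  shows "wt_ge (w + 2) (subst3 g F - g - lie_op h\<^sub>6 g)"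
proof -
  note h = wt_ge_leading_ham[of a]
  let ?G = "time_one_map h\<^sub>6"
  have x: "wt_ge (2 + 2) (lie_exp h\<^sub>6 var_x - var_x - lie_op h\<^sub>6 var_x)"
    and y: "wt_ge (3 + 2) (lie_exp h\<^sub>6 var_y - var_y - lie_op h\<^sub>6 var_y)"
    by (intro wt_ge_lie_exp_diff2 h order_ge_vars)+
  have "wt_ge (w + 2) (subst3 g F - subst3 g ?G)"
  proof (intro order_ge_subst3_diff wt_ge_F wt_ge_time_one_map h g)
    show "wt_ge (2 + 2) (fst F - fst ?G)"
      using order_ge_diff[OF fst_F x[simplified]]
      by (simp add: time_one_map_def lie_op_def deriv_leading_ham)
    show "wt_ge (3 + 2) (snd F - snd ?G)"
      using order_ge_diff[OF snd_F y[simplified]]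
      by (simp add: time_one_map_def lie_op_def deriv_leading_ham)
  qed
  from order_ge_add[OF this wt_ge_lie_exp_diff2[OF h g]]
  show ?thesis by (simp add: subst3_time_one_map[OF h] algebra_simps)
qed

text \<open>For \<open>z = var_x\<close> and \<open>z = var_y\<close> these are the components of
  \<Phi>_\<eta> \<circ> F minus those of \<Phi>_h \<circ> \<Phi>_\<eta>, written with the induced
  operators, so the exponential of \<open>h\<close> acts first.\<close>

definition conj_error :: "fps3 \<Rightarrow> fps3 \<Rightarrow> fps3 \<Rightarrow> fps3" where
  "conj_error \<eta> h z = subst3 (lie_exp \<eta> z) F - lie_exp \<eta> (lie_exp h z)"

text \<open>Undoing both exponentials on the right turns the error into the displacement of a map
  \<open>B\<close> of Jacobian 1, without changing its leading part. Expanding that Jacobian, the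
  divergence of the displacement \<open>(u, v)\<close> is \<open>- poisson u v\<close>: quadratic in
  the error, hence of weight (2 + p) + (3 + p) - 5 = 2 p.\<close>

lemma conj_error_hamiltonian:
  assumes \<eta>: "wt_ge 6 \<eta>" and h: "wt_ge 6 h" and p: "1 \<le> p"
    and x: "wt_ge (2 + p) (conj_error \<eta> h var_x)" and y: "wt_ge (3 + p) (conj_error \<eta> h var_y)"
  obtains r where "wt_ge (5 + p) r" "wt_ge (3 + p) (conj_error \<eta> h var_x - lie_op r var_x)"
    "wt_ge (4 + p) (conj_error \<eta> h var_y - lie_op r var_y)"
proof -
  have \<eta>': "wt_ge 6 (- \<eta>)" and h': "wt_ge 6 (- h)" using \<eta> h by simp_all
  define B where "B z = lie_exp (- h) (lie_exp (- \<eta>) (subst3 (lie_exp \<eta> z) F))" for z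
  have B: "B z - z = lie_exp (- h) (lie_exp (- \<eta>) (conj_error \<eta> h z))" for z
    by (simp add: B_def conj_error_def lie_exp_diff[OF h'] lie_exp_diff[OF \<eta>']
        lie_exp_inverse'[OF h] lie_exp_inverse'[OF \<eta>])
  have B1: "wt_ge w (B z - z)" if "wt_ge w (conj_error \<eta> h z)" for w z
    unfolding B by (intro wt_ge_lie_exp h' \<eta>' that)
  have B2: "wt_ge (w + 1) ((B z - z) - conj_error \<eta> h z)" if "wt_ge w (conj_error \<eta> h z)" for w z
    unfolding B
    by (rule order_ge_trans[OF wt_ge_lie_exp_diff[OF h' wt_ge_lie_exp[OF \<eta>' that]]
          wt_ge_lie_exp_diff[OF \<eta>' that]])
  define u v where "u = B var_x - var_x" and "v = B var_y - var_y"
  have uv: "wt_ge (2 + p) u" "wt_ge (3 + p) v" unfolding u_def v_def by (intro B1 x y)+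
  have "poisson (B var_x) (B var_y) = 1"
    using lie_exp_const3[of _ 1] \<eta> \<eta>' h'
    by (simp add: B_def poisson_subst3 origin_F jacobian_F flip: lie_exp_poisson)
  then have "poisson (var_x + u) (var_y + v) = 1" by (simp add: u_def v_def)
  moreover have "poisson (var_x + u) (var_y + v) = 1 + ((deriv_x u + deriv_y v) + poisson u v)"
    by (simp add: poisson_def deriv_x_add deriv_y_add algebra_simps)
  ultimately have "deriv_x u + deriv_y v = - poisson u v" by (simp add: eq_neg_iff_add_eq_0)
  then have "wt_ge (2 * p) (deriv_x u + deriv_y v)"
    using order_ge_poisson[OF uv] by (auto intro: order_ge_mono)
  then obtain r where r: "wt_ge (5 + p) r" "deriv_y r = u" "wt_ge (4 + p) (deriv_x r + v)"
    using approximate_hamiltonian[OF uv] p by blast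
  show thesis
  proof
    show "wt_ge (5 + p) r" by (rule r)
    show "wt_ge (3 + p) (conj_error \<eta> h var_x - lie_op r var_x)"
      using order_ge_minus_commute[OF B2[OF x]] by (simp add: lie_op_def r(2) numeral_3_eq_3 flip: u_def)
    have "wt_ge (4 + p) (conj_error \<eta> h var_y - v)"
      using order_ge_minus_commute[OF B2[OF y]] by (simp flip: v_def)
    from order_ge_add[OF this r(3)]
    show "wt_ge (4 + p) (conj_error \<eta> h var_y - lie_op r var_y)"
      by (simp add: lie_op_def algebra_simps)
  qed
qed

text \<open>With \<open>E_h z = z + u - v\<close>, the right-hand side changes by
  \<open>D + (E' u - E u) + E v\<close>, and the left-hand side by \<open>subst3 D F\<close>. The
  light term \<open>D\<close> cancels. Only the commutator of \<open>lie_op h\<^sub>6\<close> and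
  \<open>lie_op d\<close>, minus \<open>lie_op e z\<close>, survives at the relevant weight, and
  \<open>e\<close> is chosen to make this \<open>- lie_op r z\<close>.\<close>

lemma conj_error_update:
  assumes \<eta>: "wt_ge 6 \<eta>" and h: "wt_ge 6 h" and h6: "wt_ge 7 (h - h\<^sub>6)" and p: "2 \<le> p"
    and r: "wt_ge (5 + p) r" and d: "wt_ge (4 + p) d" and e: "e = r + poisson d h\<^sub>6" "wt_ge (5 + p) e"
    and z: "wt_ge w z" and err: "wt_ge (w + p + 1) (conj_error \<eta> h z - lie_op r z)"
  shows "wt_ge (w + p + 1) (conj_error (\<eta> + d) (h + e) z)"
proof -
  \<comment> \<open>Here \<open>2 \<le> p\<close> enters: the perturbation lemma is used with
    \<open>q = p - 1\<close>, which must be at least 1.\<close>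
  have d': "wt_ge (5 + (p - 1)) d" using d p by simp
  have "wt_ge 6 d" "wt_ge 6 e" using p by (auto intro: order_ge_mono[OF d] order_ge_mono[OF e(2)])
  then have \<eta>d: "wt_ge 6 (\<eta> + d)" and he: "wt_ge 6 (h + e)"
    using \<eta> h by (auto intro: order_ge_add)
  define E E' where "E = lie_exp \<eta>" and "E' = lie_exp (\<eta> + d)"
  define D u v where "D = E' z - E z" and "u = lie_exp (h + e) z - z" and "v = lie_exp (h + e) z - lie_exp h z"
  have E_diff: "E (f - g) = E f - E g" "E' (f - g) = E' f - E' g" for f g
    using \<eta> \<eta>d by (simp_all add: E_def E'_def lie_exp_diff)
  have pert: "wt_ge (n + p) (E' g - E g - lie_op d g)" if "wt_ge n g" for g n
    using lie_exp_perturbation[OF \<eta> d' _ that] p by (simp add: E_def E'_def)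
  have Ld: "wt_ge (n + p - 1) (lie_op d g)" if "wt_ge n g" for g n
    using wt_ge_lie_op[OF d' that] p by simp
  have L6: "wt_ge (n + 1) (lie_op h\<^sub>6 g)" if "wt_ge n g" for g n
    using wt_ge_leading_ham[of a] by (intro wt_ge_lie_op that) simp
  have D1: "wt_ge (w + p) (D - lie_op d z)" unfolding D_def by (rule pert[OF z])
  from order_ge_add[OF order_ge_mono[OF this] Ld[OF z]] p
  have D2: "wt_ge (w + p - 1) D" by simp
  have u1: "wt_ge (w + 1) u" unfolding u_def by (rule wt_ge_lie_exp_diff[OF he z])
  have "wt_ge 7 (h + e - h\<^sub>6)"
    using order_ge_add[OF h6 order_ge_mono[OF e(2)]] p by (simp add: algebra_simps)
  then have "wt_ge (w + 2) (lie_op (h + e - h\<^sub>6) z)" by (intro wt_ge_lie_op z) simp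
  from order_ge_add[OF wt_ge_lie_exp_diff2[OF he z] this]
  have u2: "wt_ge (w + 2) (u - lie_op h\<^sub>6 z)"
    by (simp add: u_def lie_op_def poisson_diff_right algebra_simps)
  have v1: "wt_ge (w + p + 1) (v - lie_op e z)"
    unfolding v_def by (rule lie_exp_perturbation[OF h e(2) _ z]) (use p in simp)
  from order_ge_add[OF order_ge_mono[OF this] wt_ge_lie_op[OF e(2) z]]
  have v2: "wt_ge (w + p) v" by simp
  have Le: "lie_op e z = lie_op r z + (lie_op h\<^sub>6 (lie_op d z) - lie_op d (lie_op h\<^sub>6 z))"
    by (simp add: e(1) lie_op_add_ham lie_op_commutator)
  \<comment> \<open>An exact identity, grouped so that each of the seven remainders has weight
    \<open>w + p + 1\<close>.\<close>
  have "conj_error (\<eta> + d) (h + e) z = (conj_error \<eta> h z - lie_op r z)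
      + (subst3 D F - D - lie_op h\<^sub>6 D) + lie_op h\<^sub>6 (D - lie_op d z)
      - (E' u - E u - lie_op d u) - lie_op d (u - lie_op h\<^sub>6 z)
      - (E v - v) - (v - lie_op e z)"
    unfolding conj_error_def E_def[symmetric] E'_def[symmetric] Le lie_op_diff
    unfolding D_def u_def v_def subst3_diff E_diff lie_op_diff by simp
  also have "wt_ge (w + p + 1) \<dots>"
  proof -
    have "wt_ge (w + p + 1) (subst3 D F - D - lie_op h\<^sub>6 D)"
      by (rule order_ge_mono[OF subst3_F_leading[OF D2]]) (use p in simp)
    moreover have "wt_ge (w + p + 1) (lie_op h\<^sub>6 (D - lie_op d z))"
      by (rule L6[OF D1])
    moreover have "wt_ge (w + p + 1) (E' u - E u - lie_op d u)"
      by (rule order_ge_mono[OF pert[OF u1]]) simp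
    moreover have "wt_ge (w + p + 1) (lie_op d (u - lie_op h\<^sub>6 z))"
      by (rule order_ge_mono[OF Ld[OF u2]]) simp
    moreover have "wt_ge (w + p + 1) (E v - v)"
      unfolding E_def by (rule wt_ge_lie_exp_diff[OF \<eta> v2])
    ultimately show ?thesis using err v1 by (metis order_ge_add order_ge_diff)
  qed
  finally show ?thesis .
qed

section \<open>The iteration and its limit\<close>

definition approx_solution :: "nat \<Rightarrow> fps3 \<Rightarrow> fps3 \<Rightarrow> bool" where
  "approx_solution n \<eta> h \<longleftrightarrow> wt_ge 6 \<eta> \<and> wt_ge 7 (h - h\<^sub>6) \<and>
     (\<forall>i j k. j \<noteq> 0 \<longrightarrow> coeff3 (h - h\<^sub>6) i j k = 0) \<and>
     wt_ge (2 + n) (conj_error \<eta> h var_x) \<and> wt_ge (3 + n) (conj_error \<eta> h var_y)"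

lemma approx_solution_wt_ge: "approx_solution n \<eta> h \<Longrightarrow> wt_ge 6 h"
  using order_ge_add[OF order_ge_mono[of 2 3 6 7 "h - h\<^sub>6" 6] wt_ge_leading_ham[of a]]
  by (simp add: approx_solution_def)

text \<open>Both \<open>F\<close> and the flow of \<open>h\<^sub>6\<close> are the identity plus
  \<open>lie_op h\<^sub>6\<close> up to excess 2, which is just the \<open>2 \<le> p\<close> that
  the iteration needs.\<close>

lemma approx_solution_start: "approx_solution 2 0 h\<^sub>6"
proof -
  have 0: "lie_exp 0 z = z" for z
    by (rule lie_exp_eq_self) (use poisson_diff_right[of z 0 0] in \<open>simp_all add: lie_op_def\<close>)
  note h = wt_ge_leading_ham[of a]
  have "wt_ge (w + 2) (conj_error 0 h\<^sub>6 z)" if "wt_ge w z" for w z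
    using order_ge_diff[OF subst3_F_leading[OF that] wt_ge_lie_exp_diff2[OF h that]]
    by (simp add: conj_error_def 0)
  from this[OF order_ge_vars(1)] this[OF order_ge_vars(2)] show ?thesis
    by (simp add: approx_solution_def)
qed

lemma approx_solution_step:
  assumes s: "approx_solution p \<eta> h" and p: "2 \<le> p"
  obtains \<eta>' h' where "approx_solution (Suc p) \<eta>' h'" "wt_ge (4 + p) (\<eta>' - \<eta>)" "wt_ge (5 + p) (h' - h)"
proof -
  have \<eta>: "wt_ge 6 \<eta>" and h6: "wt_ge 7 (h - h\<^sub>6)"
    and y: "\<And>i j k. j \<noteq> 0 \<Longrightarrow> coeff3 (h - h\<^sub>6) i j k = 0"
    and e: "wt_ge (2 + p) (conj_error \<eta> h var_x)" "wt_ge (3 + p) (conj_error \<eta> h var_y)"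
    using s unfolding approx_solution_def by blast+
  have h: "wt_ge 6 h" by (rule approx_solution_wt_ge[OF s])
  obtain r where r: "wt_ge (5 + p) r" "wt_ge (3 + p) (conj_error \<eta> h var_x - lie_op r var_x)"
    "wt_ge (4 + p) (conj_error \<eta> h var_y - lie_op r var_y)"
    using conj_error_hamiltonian[OF \<eta> h _ e] p by auto
  define e where "e d = r + poisson d h\<^sub>6" for d
  obtain d where d: "wt_ge (5 + p - 1) d" "wt_ge (5 + p) (e d)" "\<And>i j k. j \<noteq> 0 \<Longrightarrow> coeff3 (e d) i j k = 0"
    using homological_equation[OF r(1), of a] unfolding e_def by auto
  have d': "wt_ge (4 + p) d" by (rule order_ge_mono[OF d(1)]) simp
  note upd = conj_error_update[OF \<eta> h h6 p r(1) d' e_def d(2)]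
  show thesis
  proof
    show "approx_solution (Suc p) (\<eta> + d) (h + e d)"
      unfolding approx_solution_def
    proof (intro conjI allI impI)
      show "wt_ge 6 (\<eta> + d)" by (intro order_ge_add \<eta> order_ge_mono[OF d']) (use p in simp)
      have "wt_ge 7 ((h - h\<^sub>6) + e d)" by (intro order_ge_add h6 order_ge_mono[OF d(2)]) (use p in simp)
      then show "wt_ge 7 (h + e d - h\<^sub>6)" by (simp add: algebra_simps)
      show "coeff3 (h + e d - h\<^sub>6) i j k = 0" if "j \<noteq> 0" for i j k
        using y[OF that, of i k] d(3)[OF that, of i k] by simp
      show "wt_ge (2 + Suc p) (conj_error (\<eta> + d) (h + e d) var_x)"
        using upd[OF order_ge_vars(1)] r(2) by (simp add: numeral_3_eq_3)
      show "wt_ge (3 + Suc p) (conj_error (\<eta> + d) (h + e d) var_y)"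
        using upd[OF order_ge_vars(2)] r(3) by simp
    qed
  qed (use d' d(2) in simp_all)
qed

text \<open>The limits agree with the approximations modulo weights
  \<open>n + 6 = 5 + (n + 1)\<close> and more, so of the excess \<open>n + 2\<close> at least
  \<open>n + 1\<close> survives. It still tends to infinity.\<close>

lemma approx_solution_limit:
  assumes s: "approx_solution (n + 2) \<eta> h" and n: "wt_ge 6 \<eta>'" "wt_ge 6 h'"
    and d: "wt_ge (n + 6) (\<eta>' - \<eta>)" "wt_ge (n + 7) (h' - h)"
    and z: "wt_ge w z" and e: "wt_ge (w + n + 1) (conj_error \<eta> h z)"
  shows "wt_ge (w + n + 1) (conj_error \<eta>' h' z)"
proof -
  have \<eta>: "wt_ge 6 \<eta>" using s by (simp add: approx_solution_def)
  have h: "wt_ge 6 h" by (rule approx_solution_wt_ge[OF s])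
  have pert: "wt_ge (w + n + 1) (lie_exp \<eta>' g - lie_exp \<eta> g)" if "wt_ge w g" for g
    using lie_exp_perturbation0[OF n(1) \<eta> order_ge_mono[OF d(1)] _ that, of "n + 1"]
    by (simp add: add.assoc)
  have H: "wt_ge (w + n + 1) (lie_exp h' z - lie_exp h z)"
    using lie_exp_perturbation0[OF n(2) h order_ge_mono[OF d(2)] _ z, of "n + 1"]
    by (simp add: add.assoc)
  have "conj_error \<eta>' h' z = conj_error \<eta> h z + subst3 (lie_exp \<eta>' z - lie_exp \<eta> z) F
      - lie_exp \<eta>' (lie_exp h' z - lie_exp h z) - (lie_exp \<eta>' (lie_exp h z) - lie_exp \<eta> (lie_exp h z))"
    by (simp add: conj_error_def subst3_diff lie_exp_diff[OF n(1)])
  also have "wt_ge (w + n + 1) \<dots>"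
    by (intro order_ge_add order_ge_diff e pert wt_ge_subst3_F wt_ge_lie_exp n h z H)
  finally show ?thesis .
qed

lemma exact_solution:
  obtains \<eta> h where "wt_ge 6 \<eta>" "wt_ge 6 h" "\<And>i j k. j \<noteq> 0 \<Longrightarrow> coeff3 (h - h\<^sub>6) i j k = 0"
    "conj_error \<eta> h var_x = 0" "conj_error \<eta> h var_y = 0"
proof -
  have "\<exists>f. \<forall>n. (case f n of (\<eta>, h) \<Rightarrow> approx_solution (n + 2) \<eta> h) \<and>
      (wt_ge (n + 6) (fst (f (Suc n)) - fst (f n)) \<and> wt_ge (n + 7) (snd (f (Suc n)) - snd (f n)))"
  proof (rule dependent_nat_choice)
    show "\<exists>s. case s of (\<eta>, h) \<Rightarrow> approx_solution (0 + 2) \<eta> h"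
      using approx_solution_start by (intro exI[of _ "(0, h\<^sub>6)"]) (simp add: numeral_2_eq_2)
    fix s n assume "case s of (\<eta>, h) \<Rightarrow> approx_solution (n + 2) \<eta> h"
    then obtain \<eta>' h' where "approx_solution (Suc (n + 2)) \<eta>' h'" "wt_ge (4 + (n + 2)) (\<eta>' - fst s)"
      "wt_ge (5 + (n + 2)) (h' - snd s)"
      by (cases s) (use approx_solution_step in force)
    then show "\<exists>t. (case t of (\<eta>, h) \<Rightarrow> approx_solution (Suc n + 2) \<eta> h) \<and>
      (wt_ge (n + 6) (fst t - fst s) \<and> wt_ge (n + 7) (snd t - snd s))"
      by (intro exI[of _ "(\<eta>', h')"]) (simp add: ac_simps)
  qed
  then obtain f where s: "\<And>n. approx_solution (n + 2) (fst (f n)) (snd (f n))"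
    and c: "\<And>n. wt_ge (n + 6) (fst (f (Suc n)) - fst (f n))" "\<And>n. wt_ge (n + 7) (snd (f (Suc n)) - snd (f n))"
    by (auto simp: case_prod_unfold)
  obtain \<eta> where \<eta>: "\<And>n. wt_ge (n + 6) (\<eta> - fst (f n))"
    using wt_ge_limit[of 6 "\<lambda>n. fst (f n)"] c(1) by auto
  obtain h where h: "\<And>n. wt_ge (n + 7) (h - snd (f n))"
    using wt_ge_limit[of 7 "\<lambda>n. snd (f n)"] c(2) by auto
  have f6: "wt_ge 6 (fst (f n))" "wt_ge 6 (snd (f n))" for n
    using s[of n] approx_solution_wt_ge[OF s[of n]] by (simp_all add: approx_solution_def)
  have \<eta>6: "wt_ge 6 \<eta>"
    using order_ge_add[OF order_ge_mono[OF \<eta>[of 0], of 6] f6(1)[of 0]] by simp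
  have h6: "wt_ge 6 h"
    using order_ge_add[OF order_ge_mono[OF h[of 0], of 6] f6(2)[of 0]] by simp
  have err: "conj_error \<eta> h z = 0" if z: "wt_ge w z"
    and e: "\<And>n. wt_ge (w + n + 1) (conj_error (fst (f n)) (snd (f n)) z)" for w z
  proof -
    have "wt_ge N (conj_error \<eta> h z)" for N
      by (rule order_ge_mono[OF approx_solution_limit[OF s \<eta>6 h6 \<eta> h z e, of N]]) simp
    then show ?thesis using order_ge_all_imp_zero[of 2 3 6] by simp
  qed
  show thesis
  proof
    show "coeff3 (h - h\<^sub>6) i j k = 0" if "j \<noteq> 0" for i j k
    proof -
      \<comment> \<open>At this index the approximation already has the limiting coefficient,
        because the difference has weight at least \<open>?n + 7\<close>.\<close>
      let ?n = "2 * i + 3 * j + 6 * k"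
      have "coeff3 (snd (f ?n) - h\<^sub>6) i j k = 0"
        using s[of ?n] that unfolding approx_solution_def by blast
      then show ?thesis using order_geD[OF h[of ?n], of i j k] by simp
    qed
    have x: "wt_ge (2 + n + 1) (conj_error (fst (f n)) (snd (f n)) var_x)"
      and y: "wt_ge (3 + n + 1) (conj_error (fst (f n)) (snd (f n)) var_y)" for n
      using s[of n] by (auto simp: approx_solution_def intro: order_ge_mono)
    show "conj_error \<eta> h var_x = 0" by (rule err[OF order_ge_vars(1) x])
    show "conj_error \<eta> h var_y = 0" by (rule err[OF order_ge_vars(2) y])
  qed (fact \<eta>6 h6)+
qed

lemma normal_form:
  obtains \<eta> u where "wt_ge 6 \<eta>" "wt_ge 6 (normal_form_hamiltonian u)"
    "time_one_map \<eta> \<circ>\<^sub>f F = time_one_map (normal_form_hamiltonian u) \<circ>\<^sub>f time_one_map \<eta>"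
proof -
  obtain \<eta> h where \<eta>: "wt_ge 6 \<eta>" and h: "wt_ge 6 h"
    and y: "\<And>i j k. j \<noteq> 0 \<Longrightarrow> coeff3 (h - h\<^sub>6) i j k = 0"
    and e: "conj_error \<eta> h var_x = 0" "conj_error \<eta> h var_y = 0"
    using exact_solution by blast
  define u where "u k m = coeff3 h k 0 m" for k m
  have y2: "const3 (1 / 2) * var_y ^ 2 = monomial3 (1 / 2) 0 2 0"
    by (simp add: monomial3_def)
  have "normal_form_hamiltonian u = h"
  proof (rule fps3_eqI)
    fix i j k
    show "coeff3 (normal_form_hamiltonian u) i j k = coeff3 h i j k"
    proof (cases "j = 0")
      case True
      \<comment> \<open>The summation range of the potential is the bound \<open>wt_ge 6 h\<close>
        halved, so no coefficient of \<open>h\<close> is lost.\<close>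
      moreover have "coeff3 h i 0 k = 0" if "i + 3 * k < 3"
        using that by (intro order_geD[OF h]) simp
      ultimately show ?thesis
        unfolding normal_form_hamiltonian_def potential_def y2
        by (auto simp: u_def coeff3_monomial3)
    next
      case False
      then show ?thesis using y[OF False, of i k]
        unfolding normal_form_hamiltonian_def potential_def y2
        by (auto simp: leading_ham_monomials coeff3_monomial3)
    qed
  qed
  with h e \<eta> show thesis
    by (intro that[of \<eta> u])
      (simp_all add: formal_comp_def conj_error_def subst3_time_one_map, simp add: time_one_map_def)
qed

end

subsection \<open>Linear normalisation\<close>

definition linear_map :: "real \<Rightarrow> real \<Rightarrow> real \<Rightarrow> real \<Rightarrow> formal_map" where
  "linear_map p q r s = (const3 p * var_x + const3 q * var_y, const3 r * var_x + const3 s * var_y)"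

lemma fixes_origin_linear_map: "fixes_origin (linear_map p q r s)"
  by (simp add: fixes_origin_def linear_map_def coeff3_var_x coeff3_var_y)

lemma jacobian_linear_map: "jacobian (linear_map p q r s) = const3 (p * s - q * r)"
proof -
  have "const3 (p * s - q * r) = const3 p * const3 s - const3 q * const3 r"
    using const3_add[of "p * s" "- (q * r)"] by (simp add: const3_uminus const3_mult)
  then show ?thesis
    by (simp add: jacobian_def linear_map_def deriv_x_add deriv_y_add deriv_x_mult deriv_y_mult)
qed

lemma linear_map_comp:
  assumes "fixes_origin G"
  shows "linear_map p q r s \<circ>\<^sub>f G = (const3 p * fst G + const3 q * snd G, const3 r * fst G + const3 s * snd G)"
  using assms by (simp add: formal_comp_def linear_map_def subst3_add subst3_mult)

lemma linear_map_comp_linear_map: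
  "linear_map p q r s \<circ>\<^sub>f linear_map p' q' r' s' =
    linear_map (p * p' + q * r') (p * q' + q * s') (r * p' + s * r') (r * q' + s * s')"
  unfolding linear_map_comp[OF fixes_origin_linear_map]
  by (simp add: linear_map_def const3_add const3_mult algebra_simps)

lemma linear_map_id: "linear_map 1 0 0 1 = formal_id"
  by (simp add: linear_map_def formal_id_def)

lemma coeff3_subst3_linear:
  assumes "fixes_origin G"
  shows "coeff3 (subst3 f G) 1 0 0 = coeff3 f 1 0 0 * coeff3 (fst G) 1 0 0 + coeff3 f 0 1 0 * coeff3 (snd G) 1 0 0"
    and "coeff3 (subst3 f G) 0 1 0 = coeff3 f 1 0 0 * coeff3 (fst G) 0 1 0 + coeff3 f 0 1 0 * coeff3 (snd G) 0 1 0"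
proof -
  have x: "coeff3 g 1 0 0 = coeff3 (deriv_x g) 0 0 0" and y: "coeff3 g 0 1 0 = coeff3 (deriv_y g) 0 0 0" for g
    by simp_all
  show "coeff3 (subst3 f G) 1 0 0 = coeff3 f 1 0 0 * coeff3 (fst G) 1 0 0 + coeff3 f 0 1 0 * coeff3 (snd G) 1 0 0"
    unfolding x y deriv_subst3[OF assms] coeff3_add coeff3_mult_000 coeff3_subst3_000 ..
  show "coeff3 (subst3 f G) 0 1 0 = coeff3 f 1 0 0 * coeff3 (fst G) 0 1 0 + coeff3 f 0 1 0 * coeff3 (snd G) 0 1 0"
    unfolding x y deriv_subst3[OF assms] coeff3_add coeff3_mult_000 coeff3_subst3_000 ..
qed

lemma formal_comp_id: "F \<circ>\<^sub>f formal_id = F"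
  by (simp add: formal_comp_def subst3_formal_id)

lemma time_one_map_inverse:
  assumes "wt_ge 6 h"
  shows "time_one_map h \<circ>\<^sub>f time_one_map (- h) = formal_id"
proof -
  have h': "wt_ge 6 (- h)" using assms by simp
  show ?thesis
    by (simp add: formal_comp_def subst3_time_one_map[OF h'])
      (simp add: time_one_map_def formal_id_def lie_exp_inverse'[OF assms])
qed

text \<open>Below weight 4 there are only 1, \<open>x\<close>, \<open>y\<close>, and below weight 5
  also \<open>x^2\<close>, whose coefficient determines \<open>a\<close>. As \<epsilon> has weight
  6, no condition on the parameter arises.\<close>

lemma normalised_map_of_coeffs:
  assumes "jacobian F = 1" "fixes_origin F"
    "coeff3 (fst F) 1 0 0 = 1" "coeff3 (fst F) 0 1 0 = 1" "coeff3 (snd F) 1 0 0 = 0" "coeff3 (snd F) 0 1 0 = 1"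
  shows "normalised_map F (- coeff3 (snd F) 2 0 0 / 3)"
proof
  let ?a = "- coeff3 (snd F) 2 0 0 / 3"
  have x2: "const3 (3 * ?a) * var_x ^ 2 = monomial3 (- coeff3 (snd F) 2 0 0) 2 0 0"
    by (simp add: monomial3_def)
  show "wt_ge 4 (fst F - var_x - var_y)"
    unfolding order_ge_def
  proof (intro allI impI)
    fix i j k :: nat assume "2 * i + 3 * j + 6 * k < 4"
    then have "(i = 0 \<and> j = 0 \<or> i = 1 \<and> j = 0 \<or> i = 0 \<and> j = 1) \<and> k = 0" by arith
    then show "coeff3 (fst F - var_x - var_y) i j k = 0"
      using assms by (auto simp: coeff3_var_x coeff3_var_y fixes_origin_def)
  qed
  show "wt_ge 5 (snd F - var_y + const3 (3 * ?a) * var_x ^ 2)"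
    unfolding order_ge_def
  proof (intro allI impI)
    fix i j k :: nat assume "2 * i + 3 * j + 6 * k < 5"
    then have "(i = 0 \<and> j = 0 \<or> i = 1 \<and> j = 0 \<or> i = 2 \<and> j = 0 \<or> i = 0 \<and> j = 1) \<and> k = 0" by arith
    then show "coeff3 (snd F - var_y + const3 (3 * ?a) * var_x ^ 2) i j k = 0"
      unfolding x2 using assms by (auto simp: coeff3_var_y coeff3_monomial3 fixes_origin_def)
  qed
qed (rule assms)

text \<open>Columns of the matrix with entries \<open>p, q, r, s\<close>: with \<open>N\<close> the nilpotent part and \<open>N v \<noteq> 0\<close>,
  they are \<open>N v\<close> and \<open>v\<close>, scaled to make the determinant \<open>\<plusminus>1\<close>.\<close>

lemma nilpotent_normalisation:
  fixes n b c :: real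
  assumes nil: "n * n + b * c = 0" and nz: "\<not> (n = 0 \<and> b = 0 \<and> c = 0)"
  obtains p q r s where "p * s - q * r = 1 \<or> p * s - q * r = - 1"
    "n * p + b * r = 0" "c * p - n * r = 0" "n * q + b * s = p" "c * q - n * s = r"
proof -
  note result = that
  have scaled: thesis if D: "(n * v + b * w) * w - (c * v - n * w) * v \<noteq> 0" for v w
  proof -
    define D where "D = (n * v + b * w) * w - (c * v - n * w) * v"
    \<comment> \<open>The determinant is quadratic in \<open>(v, w)\<close>, so this scaling
      normalises its absolute value but keeps its sign.\<close>
    define t where "t = 1 / sqrt \<bar>D\<bar>"
    have t2: "t * t = 1 / \<bar>D\<bar>" by (simp add: t_def)
    have "(t * (n * v + b * w)) * (t * w) - (t * v) * (t * (c * v - n * w)) = t * t * D"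
      by (simp add: D_def algebra_simps)
    also have "\<dots> = 1 \<or> \<dots> = - 1"
      using D unfolding t2 D_def[symmetric] by (cases "D > 0") auto
    finally have det: "(t * (n * v + b * w)) * (t * w) - (t * v) * (t * (c * v - n * w)) = 1 \<or>
      (t * (n * v + b * w)) * (t * w) - (t * v) * (t * (c * v - n * w)) = - 1" .
    have "n * (t * (n * v + b * w)) + b * (t * (c * v - n * w)) = t * v * (n * n + b * c)"
      "c * (t * (n * v + b * w)) - n * (t * (c * v - n * w)) = t * w * (n * n + b * c)"
      by (simp_all add: algebra_simps)
    then show thesis
      unfolding nil mult_zero_right by (rule result[OF det]) (simp_all add: algebra_simps)
  qed
  show thesis
  \<comment> \<open>The second basis vector has determinant \<open>b\<close>, the first one
    \<open>- c\<close>.\<close>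
  proof (cases "c = 0")
    case True
    with nil nz have "n = 0" "b \<noteq> 0" by auto
    with scaled[of 0 1] show thesis by simp
  next
    case False
    with scaled[of 1 0] show thesis by simp
  qed
qed

section \<open>The spectral hypotheses in terms of coefficients\<close>

lemma det_mat_2:
  assumes A: "A \<in> carrier_mat 2 2"
  shows "Determinant.det A = A $$ (0, 0) * A $$ (1, 1) - A $$ (0, 1) * A $$ (1, 0)"
proof -
  have "mat_delete A i 0 \<in> carrier_mat 1 1" for i
    using mat_delete_carrier[of A 2 2 i 0] A by (simp add: numeral_2_eq_2)
  then have "Determinant.det (mat_delete A i 0) = mat_delete A i 0 $$ (0, 0)" for i
    by (rule det_single)
  then show ?thesis
    using A by (subst laplace_expansion_column[OF A, of 0])
      (auto simp: numeral_2_eq_2 cofactor_def mat_delete_def)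
qed

text \<open>A double root at 1 is a zero of the characteristic polynomial and of its derivative; the
  derivative gives the trace, and then the value gives the determinant.\<close>

lemma jacobian_matrix_0_unipotent:
  assumes ord: "order 1 (char_poly (jacobian_matrix_0 F)) = 2"
  shows "coeff3 (fst F) 1 0 0 + coeff3 (snd F) 0 1 0 = 2"
    and "coeff3 (fst F) 1 0 0 * coeff3 (snd F) 0 1 0 - coeff3 (fst F) 0 1 0 * coeff3 (snd F) 1 0 0 = 1"
proof -
  let ?a = "coeff3 (fst F) 1 0 0" and ?b = "coeff3 (fst F) 0 1 0"
    and ?c = "coeff3 (snd F) 1 0 0" and ?d = "coeff3 (snd F) 0 1 0"
  let ?p = "char_poly (jacobian_matrix_0 F)"
  have "char_poly_matrix (jacobian_matrix_0 F) \<in> carrier_mat 2 2"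
    by (simp add: jacobian_matrix_0_def mat_of_rows_list_def numeral_2_eq_2)
  then have p: "?p = [: ?a * ?d - ?b * ?c, - (?a + ?d), 1 :]"
    unfolding char_poly_def
    by (subst det_mat_2) (simp_all add: char_poly_matrix_def jacobian_matrix_0_def mat_of_rows_list_def
        numeral_2_eq_2 algebra_simps)
  obtain q where q: "?p = [:- 1, 1:] ^ 2 * q"
    using order_1[of 1 ?p] ord by (auto elim: dvdE)
  have "poly ?p 1 = 0" "poly (pderiv ?p) 1 = 0"
    unfolding q by (simp_all add: pderiv_mult pderiv_power pderiv_pCons)
  then show "?a + ?d = 2" "?a * ?d - ?b * ?c = 1"
    unfolding p by (simp_all add: pderiv_pCons)
qed

lemma jacobian_matrix_0_nontrivial:
  assumes "\<not> diagonalisable_mat (jacobian_matrix_0 F)"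
  shows "\<not> (coeff3 (fst F) 0 1 0 = 0 \<and> coeff3 (snd F) 1 0 0 = 0)"
proof
  assume z: "coeff3 (fst F) 0 1 0 = 0 \<and> coeff3 (snd F) 1 0 0 = 0"
  have "diagonal_mat (jacobian_matrix_0 F)"
    using z by (auto simp: diagonal_mat_def jacobian_matrix_0_def mat_of_rows_list_def less_Suc_eq numeral_2_eq_2)
  moreover have "jacobian_matrix_0 F \<in> carrier_mat 2 2"
    by (simp add: jacobian_matrix_0_def mat_of_rows_list_def numeral_2_eq_2)
  ultimately show False
    using assms similar_mat_refl unfolding diagonalisable_mat_def by blast
qed

lemma formal_normal_form:
  fixes F :: formal_map
  assumes jac: "jacobian F = 1 \<or> jacobian F = - 1" and origin: "fixes_origin F"
    and eig: "order 1 (char_poly (jacobian_matrix_0 F)) = 2"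
    and nondiag: "\<not> diagonalisable_mat (jacobian_matrix_0 F)"
  shows "\<exists>\<phi> \<psi> u. canonical_change \<phi> \<and> is_formal_inverse \<phi> \<psi> \<and>
           F = \<psi> \<circ>\<^sub>f (time_one_map (normal_form_hamiltonian u) \<circ>\<^sub>f \<phi>)"
proof -
  let ?a = "coeff3 (fst F) 1 0 0" and ?b = "coeff3 (fst F) 0 1 0"
    and ?c = "coeff3 (snd F) 1 0 0" and ?d = "coeff3 (snd F) 0 1 0"
  note tr = jacobian_matrix_0_unipotent(1)[OF eig] and det = jacobian_matrix_0_unipotent(2)[OF eig]
  \<comment> \<open>The constant term of the Jacobian is the determinant at the origin, which rules
    out -1.\<close>
  have "coeff3 (jacobian F) 0 0 0 = ?a * ?d - ?b * ?c"
    by (simp add: jacobian_def coeff3_mult_000)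
  with jac det have jac1: "jacobian F = 1" by auto
  have d: "?d = 2 - ?a" using tr by simp
  have "(?a - 1) * (?a - 1) + ?b * ?c = 0" using det unfolding d by (simp add: algebra_simps)
  moreover have "\<not> (?a - 1 = 0 \<and> ?b = 0 \<and> ?c = 0)"
    using jacobian_matrix_0_nontrivial[OF nondiag] by blast
  ultimately obtain p q r s where P: "p * s - q * r = 1 \<or> p * s - q * r = - 1"
    and N: "(?a - 1) * p + ?b * r = 0" "?c * p - (?a - 1) * r = 0"
      "(?a - 1) * q + ?b * s = p" "?c * q - (?a - 1) * s = r"
    by (rule nilpotent_normalisation)
  define D where "D = p * s - q * r"
  have D: "D = 1 \<or> D = - 1" "D * D = 1" using P by (auto simp: D_def)
  \<comment> \<open>\<open>L\<close> is the inverse of \<open>M\<close>: the adjugate times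
    \<open>D\<close>, which equals \<open>1 / D\<close> because \<open>D\<close> is 1 or -1.\<close>
  define M L where "M = linear_map p q r s" and "L = linear_map (D * s) (- D * q) (- D * r) (D * p)"
  have o: "fixes_origin M" "fixes_origin L" by (simp_all add: M_def L_def fixes_origin_linear_map)
  have DD: "D * (s * p) - D * (q * r) = 1" "D * (p * s) - D * (r * q) = 1"
    using D(2) by (simp_all add: D_def algebra_simps)
  have LM: "L \<circ>\<^sub>f M = formal_id" "M \<circ>\<^sub>f L = formal_id"
    using DD by (simp_all add: L_def M_def linear_map_comp_linear_map algebra_simps flip: linear_map_id)
  have "E * s * (E * p) - (- E * q) * (- E * r) = E * E * (p * s - q * r)" for E
    by (simp add: algebra_simps)
  from this[of D] have jL: "jacobian L = const3 D" "jacobian M = const3 D"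
    using D(2) unfolding L_def M_def jacobian_linear_map D_def[symmetric] by simp_all
  define G where "G = L \<circ>\<^sub>f (F \<circ>\<^sub>f M)"
  have oFM: "fixes_origin (F \<circ>\<^sub>f M)" by (rule fixes_origin_formal_comp[OF origin])
  have jG: "jacobian G = 1"
    using oFM o D(2) by (simp add: G_def jacobian_formal_comp jL jac1 flip: const3_mult)
  have oG: "fixes_origin G" unfolding G_def by (rule fixes_origin_formal_comp[OF o(2)])
  \<comment> \<open>With \<open>N\<close> the linear part minus the identity, the columns of
    \<open>M\<close> are N v and v, which the linear part sends to N v and v + N v.\<close>
  have FM: "coeff3 (fst (F \<circ>\<^sub>f M)) 1 0 0 = p" "coeff3 (snd (F \<circ>\<^sub>f M)) 1 0 0 = r"
    "coeff3 (fst (F \<circ>\<^sub>f M)) 0 1 0 = p + q" "coeff3 (snd (F \<circ>\<^sub>f M)) 0 1 0 = r + s"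
    using N unfolding formal_comp_sel coeff3_subst3_linear[OF o(1)] unfolding M_def linear_map_def
    by (simp_all add: coeff3_var_x coeff3_var_y d[simplified] algebra_simps)
  have "coeff3 (fst G) 1 0 0 = 1" "coeff3 (fst G) 0 1 0 = 1" "coeff3 (snd G) 1 0 0 = 0" "coeff3 (snd G) 0 1 0 = 1"
    using DD unfolding G_def L_def linear_map_comp[OF oFM] fst_conv snd_conv coeff3_add coeff3_const3_mult FM
    by (simp_all add: algebra_simps)
  then interpret normalised_map G "- coeff3 (snd G) 2 0 0 / 3"
    by (rule normalised_map_of_coeffs[OF jG oG])
  obtain \<eta> u where \<eta>: "wt_ge 6 \<eta>" and h: "wt_ge 6 (normal_form_hamiltonian u)"
    and conj: "time_one_map \<eta> \<circ>\<^sub>f G = time_one_map (normal_form_hamiltonian u) \<circ>\<^sub>f time_one_map \<eta>"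
    by (rule normal_form)
  define T T' H where "T = time_one_map \<eta>" and "T' = time_one_map (- \<eta>)"
    and "H = time_one_map (normal_form_hamiltonian u)"
  have oT: "fixes_origin T" "fixes_origin T'" "fixes_origin H"
    using \<eta> h by (simp_all add: T_def T'_def H_def fixes_origin_time_one_map)
  have TT: "T \<circ>\<^sub>f T' = formal_id" "T' \<circ>\<^sub>f T = formal_id"
    using time_one_map_inverse[of \<eta>] time_one_map_inverse[of "- \<eta>"] \<eta> by (simp_all add: T_def T'_def)
  \<comment> \<open>Flows have Jacobian 1, so the orientation of \<phi> is that of \<open>L\<close>,
    given by the sign \<open>D\<close>.\<close>
  define \<phi> \<psi> where "\<phi> = T \<circ>\<^sub>f L" and "\<psi> = M \<circ>\<^sub>f T'"
  note os = o oT origin fixes_origin_formal_comp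
  have cancel: "M \<circ>\<^sub>f (L \<circ>\<^sub>f X) = X" "L \<circ>\<^sub>f (M \<circ>\<^sub>f X) = X" "T \<circ>\<^sub>f (T' \<circ>\<^sub>f X) = X" "T' \<circ>\<^sub>f (T \<circ>\<^sub>f X) = X"
    if "fixes_origin X" for X
    using that by (simp_all add: LM TT os formal_id_comp flip: formal_comp_assoc)
  have "jacobian \<phi> = const3 D"
    using \<eta> o by (simp add: \<phi>_def jacobian_formal_comp jL T_def jacobian_time_one_map)
  then have "canonical_change \<phi>"
    using D(1) const3_uminus[of 1] by (auto simp: canonical_change_def \<phi>_def os)
  moreover have "is_formal_inverse \<phi> \<psi>"
    by (simp add: is_formal_inverse_def \<phi>_def \<psi>_def os formal_comp_assoc cancel LM TT)
  moreover have "F = \<psi> \<circ>\<^sub>f (H \<circ>\<^sub>f \<phi>)"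
  proof -
    have "H \<circ>\<^sub>f \<phi> = (H \<circ>\<^sub>f T) \<circ>\<^sub>f L"
      by (simp add: \<phi>_def formal_comp_assoc os)
    also have "\<dots> = (T \<circ>\<^sub>f G) \<circ>\<^sub>f L"
      using conj by (simp add: T_def H_def)
    also have "\<dots> = T \<circ>\<^sub>f (L \<circ>\<^sub>f F)"
      by (simp add: G_def formal_comp_assoc os LM formal_comp_id)
    finally show ?thesis
      by (simp add: \<psi>_def formal_comp_assoc os cancel)
  qed
  ultimately show ?thesis unfolding H_def by blast
qed

subsection \<open>Smooth functions and their Taylor series\<close>

text \<open>Partial derivatives depend only on the germ. Equalities known only on \<open>U\<close>
  can therefore be differentiated repeatedly.\<close>

lemma partial_cong:
  assumes U: "open U" "p \<in> U" and eq: "\<And>q. q \<in> U \<Longrightarrow> f q = g q"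
  shows "partial v f p = partial v g p"
proof -
  have "(f has_derivative D) (at p) \<longleftrightarrow> (g has_derivative D) (at p)" for D
    using U eq has_derivative_transform_within_open[of f D p UNIV U g]
      has_derivative_transform_within_open[of g D p UNIV U f] by auto
  then show ?thesis by (simp add: partial_def frechet_derivative_def)
qed

lemma funpow_partial_cong:
  assumes U: "open U" and eq: "\<And>q. q \<in> U \<Longrightarrow> f q = g q"
  shows "p \<in> U \<Longrightarrow> (partial v ^^ n) f p = (partial v ^^ n) g p"
proof (induction n arbitrary: p)
  case (Suc n)
  then show ?case using partial_cong[OF U, of p "(partial v ^^ n) f" "(partial v ^^ n) g"] by simp
qed (use eq in simp)

lemma Ck_on_subset: "Ck_on n U f \<Longrightarrow> V \<subseteq> U \<Longrightarrow> Ck_on n V f"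
  by (induction n arbitrary: f) (auto intro: continuous_on_subset)

lemma smooth_on_subset: "smooth_on U f \<Longrightarrow> V \<subseteq> U \<Longrightarrow> smooth_on V f"
  by (auto simp: smooth_on_def intro: Ck_on_subset)

lemma smooth_on_partial: "smooth_on U f \<Longrightarrow> v \<in> Basis \<Longrightarrow> smooth_on U (partial v f)"
  unfolding smooth_on_def by (metis Ck_on.simps(2))

lemma smooth_on_funpow_partial: "smooth_on U f \<Longrightarrow> v \<in> Basis \<Longrightarrow> smooth_on U ((partial v ^^ n) f)"
  by (induction n) (auto intro: smooth_on_partial)

lemma smooth_on_differentiable: "smooth_on U f \<Longrightarrow> p \<in> U \<Longrightarrow> f differentiable (at p)"
  unfolding smooth_on_def by (metis Ck_on.simps(2))

lemma smooth_on_has_derivative: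
  "smooth_on U f \<Longrightarrow> p \<in> U \<Longrightarrow> (f has_derivative (\<lambda>v. partial v f p)) (at p)"
  using smooth_on_differentiable[of U f p] frechet_derivative_works[of f "at p"]
  by (simp add: partial_def eta_contract_eq)

lemma smooth_on_continuous: "smooth_on U f \<Longrightarrow> continuous_on U f"
  unfolding smooth_on_def by (metis Ck_on.simps(1))

lemma partial_const [simp]: "partial v (\<lambda>_. c) = (\<lambda>_. 0)"
  by (simp add: partial_def fun_eq_iff)

lemma smooth_on_const: "smooth_on U (\<lambda>_. c)"
proof -
  have "Ck_on n U (\<lambda>_. c)" for n
    by (induction n arbitrary: c) auto
  then show ?thesis by (simp add: smooth_on_def)
qed

section \<open>Symmetry of mixed partial derivatives\<close>

lemma partial_line:
  assumes "f differentiable (at (q + a *\<^sub>R v))"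
  shows "((\<lambda>a. f (q + a *\<^sub>R v)) has_real_derivative partial v f (q + a *\<^sub>R v)) (at a)"
proof -
  let ?D = "frechet_derivative f (at (q + a *\<^sub>R v))"
  have D: "(f has_derivative ?D) (at (q + a *\<^sub>R v))"
    using assms frechet_derivative_works by blast
  have "((\<lambda>a. q + a *\<^sub>R v) has_derivative (\<lambda>a. a *\<^sub>R v)) (at a)"
    by (auto intro!: derivative_eq_intros)
  from has_derivative_compose[OF this D]
  have "((\<lambda>a. f (q + a *\<^sub>R v)) has_derivative (\<lambda>a. ?D (a *\<^sub>R v))) (at a)" .
  moreover have "?D (x *\<^sub>R v) = ?D v * x" for x
    using linear_frechet_derivative[OF assms] by (simp add: linear_cmul)
  ultimately show ?thesis by (simp add: has_field_derivative_def partial_def)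
qed

text \<open>The mean value theorem is applied along \<open>v\<close> and then along
  \<open>w\<close>. The left-hand side is symmetric in \<open>v\<close> and \<open>w\<close>, which
  is what the symmetry of mixed derivatives exploits.\<close>

lemma second_difference:
  fixes f :: "'a::euclidean_space \<Rightarrow> real"
  assumes s: "0 < s" and sub: "\<And>a b. 0 \<le> a \<Longrightarrow> a \<le> s \<Longrightarrow> 0 \<le> b \<Longrightarrow> b \<le> s \<Longrightarrow> p + a *\<^sub>R v + b *\<^sub>R w \<in> U"
    and f: "\<And>q. q \<in> U \<Longrightarrow> f differentiable (at q)" "\<And>q. q \<in> U \<Longrightarrow> partial v f differentiable (at q)"
  obtains a b where "0 < a" "a < s" "0 < b" "b < s"
    "f (p + s *\<^sub>R v + s *\<^sub>R w) - f (p + s *\<^sub>R v) - f (p + s *\<^sub>R w) + f p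
      = s * s * partial w (partial v f) (p + a *\<^sub>R v + b *\<^sub>R w)"
proof -
  define g where "g a = f (p + s *\<^sub>R w + a *\<^sub>R v) - f (p + a *\<^sub>R v)" for a
  have "\<exists>z>0. z < s \<and> g s - g 0 = (s - 0) *
      (partial v f (p + s *\<^sub>R w + z *\<^sub>R v) - partial v f (p + z *\<^sub>R v))"
  proof (rule MVT2[OF s])
    fix x assume "0 \<le> x" "x \<le> s"
    then have "p + s *\<^sub>R w + x *\<^sub>R v \<in> U" "p + x *\<^sub>R v \<in> U"
      using sub[of x s] sub[of x 0] s by (simp_all add: algebra_simps)
    then show "(g has_real_derivative partial v f (p + s *\<^sub>R w + x *\<^sub>R v) - partial v f (p + x *\<^sub>R v)) (at x)"
      unfolding g_def by (intro DERIV_diff partial_line f)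
  qed
  then obtain a where a: "0 < a" "a < s" "g s - g 0 = s *
      (partial v f (p + s *\<^sub>R w + a *\<^sub>R v) - partial v f (p + a *\<^sub>R v))" by auto
  have "\<exists>z>0. z < s \<and> partial v f (p + a *\<^sub>R v + s *\<^sub>R w) - partial v f (p + a *\<^sub>R v + 0 *\<^sub>R w) =
      (s - 0) * partial w (partial v f) (p + a *\<^sub>R v + z *\<^sub>R w)"
    using a(1,2) by (intro MVT2[OF s] partial_line f sub) auto
  then obtain b where b: "0 < b" "b < s"
    "partial v f (p + a *\<^sub>R v + s *\<^sub>R w) - partial v f (p + a *\<^sub>R v) =
      s * partial w (partial v f) (p + a *\<^sub>R v + b *\<^sub>R w)" by auto
  show thesis
    by (rule that[OF a(1,2) b(1,2)]) (use a(3) b(3) in \<open>simp add: g_def algebra_simps\<close>)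
qed

text \<open>Both mixed derivatives, at suitable points near \<open>p\<close>, equal the same second
  difference divided by \<open>s * s\<close>. If they differed at \<open>p\<close>, continuity would
  be contradicted.\<close>

lemma partial_commute:
  fixes f :: "'a::euclidean_space \<Rightarrow> real"
  assumes U: "open U" "p \<in> U" and f: "smooth_on U f" and vw: "v \<in> Basis" "w \<in> Basis"
  shows "partial v (partial w f) p = partial w (partial v f) p"
proof (rule ccontr)
  let ?A = "partial v (partial w f)" and ?B = "partial w (partial v f)"
  assume "?A p \<noteq> ?B p"
  define e where "e = \<bar>?A p - ?B p\<bar> / 2"
  have e: "0 < e" using \<open>?A p \<noteq> ?B p\<close> by (simp add: e_def)
  have sm: "smooth_on U ?A" "smooth_on U ?B" "smooth_on U (partial v f)" "smooth_on U (partial w f)"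
    using f vw by (auto intro: smooth_on_partial)
  have near: "\<exists>d>0. \<forall>q. dist q p < d \<longrightarrow> dist (h q) (h p) < e" if "smooth_on U h" for h :: "'a \<Rightarrow> real"
    using smooth_on_continuous[OF that] U e by (simp add: continuous_on_eq_continuous_at continuous_at_eps_delta)
  obtain d1 d2 where d: "0 < d1" "0 < d2" "\<And>q. dist q p < d1 \<Longrightarrow> dist (?A q) (?A p) < e"
    "\<And>q. dist q p < d2 \<Longrightarrow> dist (?B q) (?B p) < e"
    using near[OF sm(1)] near[OF sm(2)] by blast
  obtain d0 where d0: "0 < d0" "ball p d0 \<subseteq> U" using U openE by blast
  define d where "d = min d0 (min d1 d2)"
  \<comment> \<open>Two displacements of length at most \<open>s\<close> then stay strictly within
    distance \<open>d\<close>.\<close>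
  define s where "s = d / 3"
  have s: "0 < s" using d d0 by (simp add: s_def d_def)
  have dist: "dist (p + a *\<^sub>R x + b *\<^sub>R y) p < d" if "0 \<le> a" "a \<le> s" "0 \<le> b" "b \<le> s" "x \<in> Basis" "y \<in> Basis"
    for a b and x y :: 'a
  proof -
    have "dist (p + a *\<^sub>R x + b *\<^sub>R y) p = norm (a *\<^sub>R x + b *\<^sub>R y)" by (simp add: dist_norm algebra_simps)
    also have "\<dots> \<le> norm (a *\<^sub>R x) + norm (b *\<^sub>R y)" by (rule norm_triangle_ineq)
    also have "\<dots> = a + b" using that by simp
    also have "\<dots> < d" using that s by (simp add: s_def)
    finally show ?thesis .
  qed
  have sub: "p + a *\<^sub>R x + b *\<^sub>R y \<in> U" if "0 \<le> a" "a \<le> s" "0 \<le> b" "b \<le> s" "x \<in> Basis" "y \<in> Basis"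
    for a b and x y :: 'a
    using dist[OF that] d0 by (auto simp: d_def mem_ball dist_commute)
  obtain a b where ab: "0 < a" "a < s" "0 < b" "b < s"
    "f (p + s *\<^sub>R v + s *\<^sub>R w) - f (p + s *\<^sub>R v) - f (p + s *\<^sub>R w) + f p = s * s * ?B (p + a *\<^sub>R v + b *\<^sub>R w)"
    by (rule second_difference[OF s sub[OF _ _ _ _ vw] smooth_on_differentiable[OF f] smooth_on_differentiable[OF sm(3)]])
  obtain a' b' where ab': "0 < a'" "a' < s" "0 < b'" "b' < s"
    "f (p + s *\<^sub>R w + s *\<^sub>R v) - f (p + s *\<^sub>R w) - f (p + s *\<^sub>R v) + f p = s * s * ?A (p + a' *\<^sub>R w + b' *\<^sub>R v)"
    by (rule second_difference[OF s sub[OF _ _ _ _ vw(2,1)] smooth_on_differentiable[OF f] smooth_on_differentiable[OF sm(4)]])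
  have "p + s *\<^sub>R w + s *\<^sub>R v = p + s *\<^sub>R v + s *\<^sub>R w" by simp
  then have "s * s * ?B (p + a *\<^sub>R v + b *\<^sub>R w) = s * s * ?A (p + a' *\<^sub>R w + b' *\<^sub>R v)"
    using ab(5) ab'(5) by (simp only:)
  with s have "?B (p + a *\<^sub>R v + b *\<^sub>R w) = ?A (p + a' *\<^sub>R w + b' *\<^sub>R v)" by simp
  moreover have "dist (?B (p + a *\<^sub>R v + b *\<^sub>R w)) (?B p) < e"
    using ab dist[of a b v w] vw by (intro d) (auto simp: d_def)
  moreover have "dist (?A (p + a' *\<^sub>R w + b' *\<^sub>R v)) (?A p) < e"
    using ab' dist[of a' b' w v] vw by (intro d) (auto simp: d_def)
  ultimately have "dist (?A p) (?B p) < e + e"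
    using dist_triangle3[of "?A p" "?B p" "?A (p + a' *\<^sub>R w + b' *\<^sub>R v)"] by simp
  then show False by (simp add: dist_real_def e_def)
qed

lemma partial_funpow_commute:
  fixes f :: "'a::euclidean_space \<Rightarrow> real"
  assumes U: "open U" and f: "smooth_on U f" and vw: "v \<in> Basis" "w \<in> Basis"
  shows "p \<in> U \<Longrightarrow> (partial w ^^ n) (partial v f) p = partial v ((partial w ^^ n) f) p"
proof (induction n arbitrary: p)
  case (Suc n)
  have "(partial w ^^ Suc n) (partial v f) p = partial w (partial v ((partial w ^^ n) f)) p"
    using partial_cong[OF U Suc.prems Suc.IH] by simp
  also have "\<dots> = partial v ((partial w ^^ Suc n) f) p"
    using partial_commute[OF U Suc.prems smooth_on_funpow_partial[OF f vw(2), of n] vw(2,1)] by simp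
  finally show ?case .
qed simp

section \<open>Compatibility of Taylor series with derivatives and products\<close>

definition taylor3 :: "(real \<times> real \<times> real \<Rightarrow> real) \<Rightarrow> fps3" where
  "taylor3 g = series3 (taylor_coeff g 0)"

definition deriv_eps :: "fps3 \<Rightarrow> fps3" where
  "deriv_eps f = Abs_fps (\<lambda>i. Abs_fps (\<lambda>j. fps_deriv (fps_nth (fps_nth f i) j)))"

lemma coeff3_deriv_eps [simp]: "coeff3 (deriv_eps f) i j k = real (k + 1) * coeff3 f i j (k + 1)"
  by (simp add: coeff3_def deriv_eps_def)

lemma deriv_eps_mult: "deriv_eps (f * g) = deriv_eps f * g + f * deriv_eps g"
proof -
  have d: "fps_deriv (fps_nth (u * v) j) = fps_nth (Abs_fps (\<lambda>j. fps_deriv (fps_nth u j)) * v) j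
      + fps_nth (u * Abs_fps (\<lambda>j. fps_deriv (fps_nth v j))) j" for u v :: "real fps fps" and j
    by (simp add: fps_mult_nth fps_deriv_sum sum.distrib)
  have deriv_eps_nth: "fps_nth (deriv_eps f) i = Abs_fps (\<lambda>j. fps_deriv (fps_nth (fps_nth f i) j))" for f i
    by (simp add: deriv_eps_def)
  show ?thesis
  proof (intro fps_ext)
    fix i j k
    have "fps_deriv (fps_nth (fps_nth (f * g) i) j) = (\<Sum>l=0..i. fps_deriv (fps_nth (fps_nth f l * fps_nth g (i - l)) j))"
      by (simp add: fps_mult_nth[of f g] fps_sum_nth fps_deriv_sum)
    also have "\<dots> = fps_nth (fps_nth (deriv_eps f * g + f * deriv_eps g) i) j"
      by (simp add: d sum.distrib fps_mult_nth[of "deriv_eps f"] fps_mult_nth[of f "deriv_eps g"] fps_sum_nth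
          deriv_eps_nth)
    finally show "fps_nth (fps_nth (fps_nth (deriv_eps (f * g)) i) j) k
      = fps_nth (fps_nth (fps_nth (deriv_eps f * g + f * deriv_eps g) i) j) k"
      by (simp add: deriv_eps_def)
  qed
qed

lemma Basis_partials: "(1, 0, 0) \<in> (Basis :: (real \<times> real \<times> real) set)"
  "(0, 1, 0) \<in> (Basis :: (real \<times> real \<times> real) set)" "(0, 0, 1) \<in> (Basis :: (real \<times> real \<times> real) set)"
  by (auto simp: Basis_prod_def zero_prod_def)

text \<open>In \<open>taylor_coeff\<close> the \<epsilon>-derivatives are innermost and the
  \<open>x\<close>-derivatives outermost. An extra \<open>y\<close>-derivative must pass the
  \<epsilon>-derivatives, and an extra \<open>x\<close>-derivative both other kinds; this is where
  symmetry of mixed derivatives enters.\<close>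

lemma deriv_taylor3:
  assumes U: "open U" "0 \<in> U" and g: "smooth_on U g"
  shows "deriv_x (taylor3 g) = taylor3 (partial_x g)" "deriv_y (taylor3 g) = taylor3 (partial_y g)"
    "deriv_eps (taylor3 g) = taylor3 (partial_eps g)"
proof -
  note c = partial_funpow_commute[OF U(1) _ Basis_partials(1) Basis_partials(2)]
    partial_funpow_commute[OF U(1) _ Basis_partials(1) Basis_partials(3)]
    partial_funpow_commute[OF U(1) _ Basis_partials(2) Basis_partials(3)]
  note s = smooth_on_funpow_partial[OF _ Basis_partials(2)] smooth_on_funpow_partial[OF _ Basis_partials(3)]
  have y: "(partial_y ^^ j) ((partial_eps ^^ k) (partial_y g)) p = (partial_y ^^ Suc j) ((partial_eps ^^ k) g) p"
    if "p \<in> U" for p j k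
    using funpow_partial_cong[OF U(1) c(3)[OF g] that] by (simp add: funpow_swap1)
  have x: "(partial_y ^^ j) ((partial_eps ^^ k) (partial_x g)) p = partial_x ((partial_y ^^ j) ((partial_eps ^^ k) g)) p"
    if "p \<in> U" for p j k
    using funpow_partial_cong[OF U(1) c(2)[OF g] that] c(1)[OF s(2)[OF g] that] by simp
  show "deriv_x (taylor3 g) = taylor3 (partial_x g)"
  proof (intro fps3_eqI)
    fix i j k
    have "(partial_x ^^ i) ((partial_y ^^ j) ((partial_eps ^^ k) (partial_x g))) 0
        = (partial_x ^^ Suc i) ((partial_y ^^ j) ((partial_eps ^^ k) g)) 0"
      using funpow_partial_cong[OF U(1) x U(2)] by (simp add: funpow_swap1)
    then show "coeff3 (deriv_x (taylor3 g)) i j k = coeff3 (taylor3 (partial_x g)) i j k"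
      by (simp add: taylor3_def taylor_coeff_def divide_simps del: of_nat_Suc funpow.simps)
  qed
  show "deriv_y (taylor3 g) = taylor3 (partial_y g)"
  proof (intro fps3_eqI)
    fix i j k
    have "(partial_x ^^ i) ((partial_y ^^ j) ((partial_eps ^^ k) (partial_y g))) 0
        = (partial_x ^^ i) ((partial_y ^^ Suc j) ((partial_eps ^^ k) g)) 0"
      using funpow_partial_cong[OF U(1) y U(2)] by simp
    then show "coeff3 (deriv_y (taylor3 g)) i j k = coeff3 (taylor3 (partial_y g)) i j k"
      by (simp add: taylor3_def taylor_coeff_def divide_simps del: of_nat_Suc funpow.simps)
  qed
  show "deriv_eps (taylor3 g) = taylor3 (partial_eps g)"
    by (intro fps3_eqI)
      (simp add: taylor3_def taylor_coeff_def divide_simps funpow_swap1 del: of_nat_Suc)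
qed

text \<open>Both sides have the same constant term, and differentiation turns the identity into the same
  identity for a longer list.\<close>

lemma taylor3_sum_of_products:
  assumes U: "open U" "0 \<in> U"
  shows "smooth_on U u \<Longrightarrow> (\<And>c g h. (c, g, h) \<in> set l \<Longrightarrow> smooth_on U g \<and> smooth_on U h) \<Longrightarrow>
    (\<And>q. q \<in> U \<Longrightarrow> u q = (\<Sum>(c, g, h)\<leftarrow>l. c * (g q * h q))) \<Longrightarrow>
    coeff3 (taylor3 u) i j k = coeff3 (\<Sum>(c, g, h)\<leftarrow>l. const3 c * (taylor3 g * taylor3 h)) i j k"
proof (induction "i + j + k" arbitrary: u l i j k)
  case 0
  have t: "coeff3 (taylor3 g) 0 0 0 = g 0" for g by (simp add: taylor3_def taylor_coeff_def)
  have "coeff3 (\<Sum>(c, g, h)\<leftarrow>l. const3 c * (taylor3 g * taylor3 h)) 0 0 0 = (\<Sum>(c, g, h)\<leftarrow>l. c * (g 0 * h 0))"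
    by (induction l) (auto simp: t coeff3_mult_000)
  with 0 U show ?case by (simp add: t)
next
  case (Suc n)
  \<comment> \<open>The product rule at the level of lists: each product contributes two
    entries.\<close>
  define d where "d v = concat (map (\<lambda>(c, g, h). [(c, partial v g, h), (c, g, partial v h)]) l)"
    for v :: "real \<times> real \<times> real"
  have d_smooth: "smooth_on U g \<and> smooth_on U h" if "v \<in> Basis" "(c, g, h) \<in> set (d v)" for v c g h
    using that Suc.prems(2) by (auto simp: d_def intro: smooth_on_partial)
  have d_u: "partial v u q = (\<Sum>(c, g, h)\<leftarrow>d v. c * (g q * h q))" if q: "q \<in> U" for v q
  proof -
    have "((\<lambda>q. \<Sum>(c, g, h)\<leftarrow>l. c * (g q * h q)) has_derivative
        (\<lambda>w. \<Sum>(c, g, h)\<leftarrow>d w. c * (g q * h q))) (at q)"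
      using Suc.prems(2) unfolding d_def
    proof (induction l)
      case (Cons t l)
      obtain c g h where t: "t = (c, g, h)" by (cases t)
      have "(g has_derivative (\<lambda>w. partial w g q)) (at q)" "(h has_derivative (\<lambda>w. partial w h q)) (at q)"
        using Cons.prems[of c g h] q by (auto simp: t intro: smooth_on_has_derivative)
      then have "((\<lambda>q. c * (g q * h q)) has_derivative
          (\<lambda>w. c * (partial w g q * h q) + c * (g q * partial w h q))) (at q)"
        by (auto intro!: derivative_eq_intros simp: algebra_simps)
      from has_derivative_add[OF this Cons.IH] Cons.prems show ?case
        by (auto simp: t add.assoc)
    qed simp
    then have "partial v (\<lambda>q. \<Sum>(c, g, h)\<leftarrow>l. c * (g q * h q)) q = (\<Sum>(c, g, h)\<leftarrow>d v. c * (g q * h q))"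
      unfolding partial_def by (simp flip: frechet_derivative_at)
    then show ?thesis using partial_cong[OF U(1) q Suc.prems(3)] by simp
  qed
  have IH: "coeff3 (taylor3 (partial v u)) i' j' k'
      = coeff3 (\<Sum>(c, g, h)\<leftarrow>d v. const3 c * (taylor3 g * taylor3 h)) i' j' k'"
    if "n = i' + j' + k'" "v \<in> Basis" for v i' j' k'
    using Suc.prems(1) that d_smooth[OF that(2)] d_u
    by (intro Suc.hyps(1) smooth_on_partial) auto
  define S where "S = (\<Sum>(c, g, h)\<leftarrow>l. const3 c * (taylor3 g * taylor3 h))"
  have z: "deriv_x 0 = 0" "deriv_y 0 = 0" "deriv_eps 0 = 0" "deriv_eps (const3 c) = 0" for c
    by (intro fps3_eqI; simp)+
  have ea: "deriv_eps (f + g) = deriv_eps f + deriv_eps g" for f g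
    by (intro fps3_eqI) (simp add: algebra_simps)
  \<comment> \<open>The derivation is abstract, so one induction serves all three variables.\<close>
  have d_S: "\<delta> S = (\<Sum>(c, g, h)\<leftarrow>d v. const3 c * (taylor3 g * taylor3 h))"
    if \<delta>: "\<delta> 0 = 0" "\<And>c. \<delta> (const3 c) = 0" "\<And>f g. \<delta> (f + g) = \<delta> f + \<delta> g"
      "\<And>f g. \<delta> (f * g) = \<delta> f * g + f * \<delta> g" "\<And>g. smooth_on U g \<Longrightarrow> \<delta> (taylor3 g) = taylor3 (partial v g)"
    for \<delta> v
    using Suc.prems(2) unfolding S_def d_def
  proof (induction l)
    case (Cons t l)
    obtain c g h where t: "t = (c, g, h)" by (cases t)
    have "smooth_on U g" "smooth_on U h" using Cons.prems[of c g h] by (auto simp: t)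
    with Cons.IH[OF Cons.prems[OF list.set_intros(2)]] show ?case
      by (simp add: t \<delta> algebra_simps)
  qed (simp add: \<delta>)
  have "deriv_x S = (\<Sum>(c, g, h)\<leftarrow>d (1, 0, 0). const3 c * (taylor3 g * taylor3 h))"
    by (rule d_S) (simp_all add: z deriv_x_add deriv_x_mult deriv_taylor3[OF U])
  moreover have "deriv_y S = (\<Sum>(c, g, h)\<leftarrow>d (0, 1, 0). const3 c * (taylor3 g * taylor3 h))"
    by (rule d_S) (simp_all add: z deriv_y_add deriv_y_mult deriv_taylor3[OF U])
  moreover have "deriv_eps S = (\<Sum>(c, g, h)\<leftarrow>d (0, 0, 1). const3 c * (taylor3 g * taylor3 h))"
    by (rule d_S) (simp_all add: z ea deriv_eps_mult deriv_taylor3[OF U])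
  ultimately have D: "n = i' + j' + k' \<Longrightarrow> coeff3 (deriv_x (taylor3 u)) i' j' k' = coeff3 (deriv_x S) i' j' k'"
    "n = i' + j' + k' \<Longrightarrow> coeff3 (deriv_y (taylor3 u)) i' j' k' = coeff3 (deriv_y S) i' j' k'"
    "n = i' + j' + k' \<Longrightarrow> coeff3 (deriv_eps (taylor3 u)) i' j' k' = coeff3 (deriv_eps S) i' j' k'" for i' j' k'
    unfolding deriv_taylor3[OF U Suc.prems(1)] by (simp_all only: IH Basis_partials)
  \<comment> \<open>A coefficient of positive degree has a positive exponent in some variable, and
    it is recovered from the derivative in that variable.\<close>
  show ?case unfolding S_def[symmetric]
  proof (cases "0 < i")
    case True
    with Suc.hyps(2) D(1)[of "i - 1" j k] show "coeff3 (taylor3 u) i j k = coeff3 S i j k" by simp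
  next
    case i: False
    show "coeff3 (taylor3 u) i j k = coeff3 S i j k"
    proof (cases "0 < j")
      case True
      with Suc.hyps(2) D(2)[of i "j - 1" k] show ?thesis by simp
    next
      case False
      with i Suc.hyps(2) D(3)[of i j "k - 1"] show ?thesis by simp
    qed
  qed
qed

lemma taylor3_const: "taylor3 (\<lambda>_. c) = const3 c"
proof (intro fps3_eqI)
  have z: "(partial v ^^ n) (\<lambda>_. c) = (\<lambda>_. if n = 0 then c else 0)" for v :: "real \<times> real \<times> real" and n c
    by (induction n) auto
  fix i j k show "coeff3 (taylor3 (\<lambda>_. c)) i j k = coeff3 (const3 c) i j k"
    by (auto simp: taylor3_def taylor_coeff_def z)
qed

text \<open>The hypothesis bounds only the absolute value of the Jacobian. Once its sign is known to
  be constant near 0, the Jacobian is a sum of products with constant value, and its Taylor series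
  is that constant.\<close>

lemma smooth_area_preserving_imp_formal:
  assumes "smooth_area_preserving_family U f"
  shows "formal_area_preserving_family (taylor_map f)"
proof -
  let ?g = "fst \<circ> f" and ?h = "snd \<circ> f"
  have U: "open U" "0 \<in> U" and smU: "smooth_on U ?g" "smooth_on U ?h"
    and ap: "area_preserving_on U f"
    using assms by (auto simp: smooth_area_preserving_family_def)
  \<comment> \<open>A ball is connected, whereas on \<open>U\<close> the sign could differ between
    components.\<close>
  obtain e where e: "0 < e" "ball 0 e \<subseteq> U" using U openE by blast
  define B where "B = ball (0 :: real \<times> real \<times> real) e"
  have B: "open B" "0 \<in> B" "connected B" using e by (auto simp: B_def)
  have sm: "smooth_on B ?g" "smooth_on B ?h" using smU e by (auto simp: B_def intro: smooth_on_subset)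
  define J where "J p = partial_x ?g p * partial_y ?h p - partial_y ?g p * partial_x ?h p" for p
  note smp = smooth_on_partial[OF sm(1)] smooth_on_partial[OF sm(2)]
  have J_cont: "continuous_on B J"
    unfolding J_def by (intro continuous_intros smooth_on_continuous smp Basis_partials)
  have J1: "J p = 1 \<or> J p = - 1" if "p \<in> B" for p
    using ap that e unfolding area_preserving_on_def J_def B_def by (smt (verit) subsetD)
  then have "J ` B \<subseteq> {1, - 1}" by blast
  then have "finite (J ` B)" by (rule finite_subset) simp
  with J_cont have "J constant_on B" using continuous_finite_range_constant B(3) by blast
  then obtain s where s: "\<And>p. p \<in> B \<Longrightarrow> J p = s" unfolding constant_on_def by blast
  with J1[OF B(2)] B(2) have s1: "s = 1 \<or> s = - 1" by auto
  let ?l = "[(1, partial_x ?g, partial_y ?h), (- 1, partial_y ?g, partial_x ?h)]"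
  have "taylor3 (\<lambda>_. s) = (\<Sum>(c, g, h)\<leftarrow>?l. const3 c * (taylor3 g * taylor3 h))"
  proof (intro fps3_eqI taylor3_sum_of_products[OF B(1,2)] smooth_on_const)
    show "smooth_on B g \<and> smooth_on B h" if "(c, g, h) \<in> set ?l" for c g h
      using that smp Basis_partials by auto
    show "s = (\<Sum>(c, g, h)\<leftarrow>?l. c * (g q * h q))" if "q \<in> B" for q
      using s[OF that] by (simp add: J_def)
  qed
  also have "\<dots> = jacobian (taylor_map f)"
    using deriv_taylor3[OF B(1,2) sm(1)] deriv_taylor3[OF B(1,2) sm(2)] const3_uminus[of 1]
    by (simp add: jacobian_def taylor_map_def taylor3_def)
  finally have "jacobian (taylor_map f) = const3 s" by (simp add: taylor3_const)
  then show ?thesis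
    using s1 const3_uminus[of 1] by (auto simp: formal_area_preserving_family_def)
qed

lemma analytic_area_preserving_imp_smooth:
  "analytic_area_preserving_family U f \<Longrightarrow> smooth_area_preserving_family U f"
  by (simp add: analytic_area_preserving_family_def smooth_area_preserving_family_def real_analytic_on_def)

theorem theorem1:
  fixes F :: formal_map
  assumes family: "formal_area_preserving_family F
      \<or> (\<exists>U f. smooth_area_preserving_family U f \<and> F = taylor_map f)
      \<or> (\<exists>U f. analytic_area_preserving_family U f \<and> F = taylor_map f)"
    and origin: "fixes_origin F"
    and double_eigenvalue: "order 1 (char_poly (jacobian_matrix_0 F)) = 2"
    and not_diagonalisable: "\<not> diagonalisable_mat (jacobian_matrix_0 F)"
  shows "\<exists>\<phi> \<psi> u. canonical_change \<phi> \<and> is_formal_inverse \<phi> \<psi> \<and>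
           F = \<psi> \<circ>\<^sub>f (time_one_map (normal_form_hamiltonian u) \<circ>\<^sub>f \<phi>)"
proof (rule formal_normal_form[OF _ origin double_eigenvalue not_diagonalisable])
  have "formal_area_preserving_family F"
    using family smooth_area_preserving_imp_formal analytic_area_preserving_imp_smooth by blast
  then show "jacobian F = 1 \<or> jacobian F = - 1"
    by (simp add: formal_area_preserving_family_def)
qed

end
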